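(* Let $k\in\mathbb{N}$ and $n_1,\dots,n_k\in\{2,3,4,\dots\}$ with $n_1-1\mid n_j-1$ for all $j\in\{1,\dots,k\}$. There exists a fixed $c\in\mathbb{N}$ such that for every positive word $w$ in $F(n_1,\dots,n_k)$, $$|w|_X<c\,L(w).$$
   Context: $F(n_1,\dots,n_k)$ is the group (product $xy=x\circ y$) of piecewise-linear orientation-preserving homeomorphisms of $[0,1]$ with finitely many breakpoints, all in $\mathbb{Z}[\frac{1}{n_1\cdots n_k}]$, and slopes in the multiplicative group $\langle n_1,\dots,n_k\rangle$. An $n$-ary caret (caret of type $n$) has one parent vertex joined by $n$ edges to $n$ child vertices, ordered from left to right. An $(n_1,\dots,n_k)$-ary tree is a rooted tree formed from finitely many (possibly zero) carets of types in $\{n_1,\dots,n_k\}$ by identifying child vertices of carets with parent vertices of other carets. Leaves are numbered $0,1,2,\dots$ from left to right. The root represents $[0,1]$, and the children of an $n$-ary caret represent, from left to right, the $n$ equal consecutive closed subintervals of the parent's interval. A tree-pair diagram $(T_-,T_+)$ is an ordered pair of such trees with equally many leaves (domain tree $T_-$, range tree $T_+$); it represents the element mapping the $i$th leaf interval of $T_-$ affinely and increasingly onto the $i$th leaf interval of $T_+$, for all $i$. Every element is represented by some diagram. A diagram is minimal if it has the fewest leaves among all diagrams representing the same element; $L(x)$ is the number of leaves in either tree of a minimal diagram for $x$. Generators. A right $n_1$-string is a tree all of whose carets are of type $n_1$ and have an edge on the rightmost root-to-leaf path. For $j\in\{2,\dots,k\}$, $i\ge0$, $(y_j)_i$ has range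 tree a right $n_1$-string of $i$ carets with an $n_j$-ary caret attached to its last leaf, and domain tree the right $n_1$-string with the same number of leaves. For $j\in\{1,\dots,k\}$, $i\ge 0$, $(z_j)_i$ has range tree a right $n_1$-string of $\lfloor i/(n_1-1)\rfloor+1$ carets with an $n_j$-ary caret attached to the leaf numbered $i$, and domain tree the right $n_1$-string with the same number of leaves. The standard finite generating set is $X=\{(y_i)_0,\dots,(y_i)_{n_i-1}: 2\le i\le k\}\cup\{(z_j)_0,\dots,(z_j)_{n_j-1}:1\le j\le k\}$, and $|x|_X$ is the word length of $x$ with respect to $X$. A positive tree-pair diagram is one whose domain tree is a right $n_1$-string; the positive words are precisely the elements having a positive tree-pair diagram representative. *)

theory Defs
  imports "HOL-Analysis.Analysis" "HOL-Algebra.Bij" "HOL-Library.Extended_Nat"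
begin

text \<open>
  The tuple \<open>(n\<^sub>1, \<dots>, n\<^sub>k)\<close> is given by \<open>k :: nat\<close> and \<open>n :: nat \<Rightarrow> nat\<close>; only the values
  \<open>n 1, \<dots>, n k\<close> are ever used.
\<close>

definition Zinv :: "nat \<Rightarrow> real set" where
  "Zinv N = {of_int a / of_nat N ^ m | (a :: int) (m :: nat). True}"

definition slope_group :: "nat \<Rightarrow> (nat \<Rightarrow> nat) \<Rightarrow> real set" where
  "slope_group k n = {\<Prod>j\<in>{1..k}. real (n j) powi e j | e :: nat \<Rightarrow> int. True}"

text \<open>
  In \<open>thompson_stein\<close> the set \<open>B\<close> is any finite set containing the breakpoints. As in
  \<^const>\<open>BijGroup\<close>, elements are \<^const>\<open>undefined\<close> outside \<open>[0,1]\<close>, and \<open>x \<otimes> y\<close> is \<open>x \<circ> y\<close> on \<open>[0,1]\<close>.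
\<close>

definition thompson_stein :: "nat \<Rightarrow> (nat \<Rightarrow> nat) \<Rightarrow> (real \<Rightarrow> real) monoid" where
  "thompson_stein k n = (BijGroup {0..1}) \<lparr> carrier :=
     {f \<in> Bij {0..1}. (\<exists>g. homeomorphism {0..1} {0..1} f g) \<and> strict_mono_on {0..1} f \<and>
        (\<exists>B. finite B \<and> B \<subseteq> Zinv (\<Prod>j\<in>{1..k}. n j) \<and>
          (\<forall>a b. 0 \<le> a \<and> a < b \<and> b \<le> 1 \<and> {a<..<b} \<inter> B = {} \<longrightarrow>
            (\<exists>s\<in>slope_group k n. \<forall>x\<in>{a..b}. f x = f a + s * (x - a))))} \<rparr>"

datatype tree = Leaf | Caret "tree list"

fun ary_tree :: "nat set \<Rightarrow> tree \<Rightarrow> bool" where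
  "ary_tree A Leaf \<longleftrightarrow> True"
| "ary_tree A (Caret ts) \<longleftrightarrow> length ts \<in> A \<and> (\<forall>t\<in>set ts. ary_tree A t)"

fun leaves :: "tree \<Rightarrow> nat" where
  "leaves Leaf = 1"
| "leaves (Caret ts) = sum_list (map leaves ts)"

text \<open>
  \<open>leaf_intervals t a b\<close> lists, from left to right, the endpoint pairs of the leaf intervals of \<open>t\<close>
  when its root represents \<open>[a,b]\<close>. \<open>child_intervals ts a d\<close> does this for the subtrees \<open>ts\<close>
  whose roots represent consecutive intervals of length \<open>d\<close> starting at \<open>a\<close>.
\<close>

fun leaf_intervals :: "tree \<Rightarrow> real \<Rightarrow> real \<Rightarrow> (real \<times> real) list"
  and child_intervals :: "tree list \<Rightarrow> real \<Rightarrow> real \<Rightarrow> (real \<times> real) list" where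
  "leaf_intervals Leaf a b = [(a, b)]"
| "leaf_intervals (Caret ts) a b = child_intervals ts a ((b - a) / real (length ts))"
| "child_intervals [] a d = []"
| "child_intervals (t # ts) a d = leaf_intervals t a (a + d) @ child_intervals ts (a + d) d"

definition maps_affinely :: "(real \<Rightarrow> real) \<Rightarrow> real \<times> real \<Rightarrow> real \<times> real \<Rightarrow> bool" where
  "maps_affinely f I J \<longleftrightarrow>
     (\<forall>x\<in>{fst I..snd I}. f x = fst J + (x - fst I) * ((snd J - fst J) / (snd I - fst I)))"

definition tree_pair_diagram :: "nat \<Rightarrow> (nat \<Rightarrow> nat) \<Rightarrow> tree \<Rightarrow> tree \<Rightarrow> bool" where
  "tree_pair_diagram k n S T \<longleftrightarrow>
     ary_tree (n ` {1..k}) S \<and> ary_tree (n ` {1..k}) T \<and> leaves S = leaves T"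

text \<open>The domain tree comes first, the range tree second.\<close>

definition represents :: "nat \<Rightarrow> (nat \<Rightarrow> nat) \<Rightarrow> tree \<Rightarrow> tree \<Rightarrow> (real \<Rightarrow> real) \<Rightarrow> bool" where
  "represents k n S T x \<longleftrightarrow>
     tree_pair_diagram k n S T \<and> x \<in> carrier (thompson_stein k n) \<and>
     (\<forall>i < leaves S. maps_affinely x (leaf_intervals S 0 1 ! i) (leaf_intervals T 0 1 ! i))"

definition min_leaves :: "nat \<Rightarrow> (nat \<Rightarrow> nat) \<Rightarrow> (real \<Rightarrow> real) \<Rightarrow> nat" where
  "min_leaves k n x = (LEAST l. \<exists>S T. represents k n S T x \<and> leaves S = l)"

fun right_string :: "nat \<Rightarrow> nat \<Rightarrow> tree" where
  "right_string p 0 = Leaf"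
| "right_string p (Suc m) = Caret (replicate (p - 1) Leaf @ [right_string p m])"

definition positive_words :: "nat \<Rightarrow> (nat \<Rightarrow> nat) \<Rightarrow> (real \<Rightarrow> real) set" where
  "positive_words k n = {x. \<exists>m T. represents k n (right_string (n 1) m) T x}"

text \<open>\<open>graft t i u\<close> replaces the leaf of \<open>t\<close> numbered \<open>i\<close> (counting from 0) by the tree \<open>u\<close>.\<close>

fun graft :: "tree \<Rightarrow> nat \<Rightarrow> tree \<Rightarrow> tree"
  and graft_list :: "tree list \<Rightarrow> nat \<Rightarrow> tree \<Rightarrow> tree list" where
  "graft Leaf i u = (if i = 0 then u else Leaf)"
| "graft (Caret ts) i u = Caret (graft_list ts i u)"
| "graft_list [] i u = []"
| "graft_list (t # ts) i u =
     (if i < leaves t then graft t i u # ts else t # graft_list ts (i - leaves t) u)"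

definition single_caret :: "nat \<Rightarrow> tree" where
  "single_caret p = Caret (replicate p Leaf)"

definition y_range :: "(nat \<Rightarrow> nat) \<Rightarrow> nat \<Rightarrow> nat \<Rightarrow> tree" where
  "y_range n j i = (let R = right_string (n 1) i in graft R (leaves R - 1) (single_caret (n j)))"

definition z_range :: "(nat \<Rightarrow> nat) \<Rightarrow> nat \<Rightarrow> nat \<Rightarrow> tree" where
  "z_range n j i = graft (right_string (n 1) (i div (n 1 - 1) + 1)) i (single_caret (n j))"

text \<open>The positive element with range tree \<open>T\<close>; the condition on \<open>m\<close> is part of \<^const>\<open>represents\<close>
  (equal numbers of leaves), and it has a solution because \<open>n 1 - 1\<close> divides every \<open>n j - 1\<close>.\<close>

definition positive_element :: "nat \<Rightarrow> (nat \<Rightarrow> nat) \<Rightarrow> tree \<Rightarrow> (real \<Rightarrow> real)" where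
  "positive_element k n T = (THE x. \<exists>m. represents k n (right_string (n 1) m) T x)"

definition standard_generators :: "nat \<Rightarrow> (nat \<Rightarrow> nat) \<Rightarrow> (real \<Rightarrow> real) set" where
  "standard_generators k n =
     {positive_element k n (y_range n j i) | j i. j \<in> {2..k} \<and> i \<in> {0..n j - 1}} \<union>
     {positive_element k n (z_range n j i) | j i. j \<in> {1..k} \<and> i \<in> {0..n j - 1}}"

text \<open>Elements outside the subgroup generated by \<open>X\<close> get word length \<open>\<infinity>\<close>.\<close>

definition word_length :: "('a, 'b) monoid_scheme \<Rightarrow> 'a set \<Rightarrow> 'a \<Rightarrow> enat" where
  "word_length G X x =
     (INF ws \<in> {ws. set ws \<subseteq> X \<union> m_inv G ` X \<and> foldr (mult G) ws (one G) = x}. enat (length ws))"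

end

theory Submission
  imports Defs "HOL-Computational_Algebra.Primes"
begin

text \<open>
  Adding a caret of type \<open>n\<^sub>j\<close> at leaf \<open>i\<close> of the range tree of a positive element multiplies it on the
  right by one of the infinite generators \<open>(y\<^sub>j)\<^sub>i\<close>, \<open>(z\<^sub>j)\<^sub>i\<close>, and conjugation by \<open>(z\<^sub>1)\<^sub>0\<close> shifts the
  index of such a generator. If the range tree is built in preorder, the leaf numbers never decrease,
  so the conjugating powers of \<open>(z\<^sub>1)\<^sub>0\<close> telescope and the word length is linear in the number of
  leaves of any positive diagram.

  It remains to compare the smallest positive diagram with a minimal one. If the element were affine
  on the part of \<open>[0,1]\<close> covered by the last two carets of the right string, a common last caret
  could be removed. So some \<open>1 - r / n\<^sub>1\<^sup>m\<close> with \<open>0 < r \<le> n\<^sub>1\<^sup>2\<close>, where \<open>m\<close> is the number of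
  carets of the right string, is a breakpoint, hence an endpoint of a leaf interval of every domain
  tree. As the endpoints of a tree with \<open>s\<close> leaves lie in \<open>(n\<^sub>1 \<cdots> n\<^sub>k)\<^sup>-\<^sup>s \<int>\<close>, this bounds
  \<open>m\<close> linearly in \<open>s\<close>.
\<close>

section \<open>Piecewise affine maps between subdivisions\<close>

text \<open>The strict inequality excludes degenerate intervals, on which the slope in
  \<open>maps_affinely\<close> would be a division by zero.\<close>

fun tiles :: "(real \<times> real) list \<Rightarrow> real \<Rightarrow> real \<Rightarrow> bool" where
  "tiles [] a b \<longleftrightarrow> a = b"
| "tiles (I # L) a b \<longleftrightarrow> fst I = a \<and> a < snd I \<and> tiles L (snd I) b"

lemma tiles_append: "tiles (L @ M) a b \<longleftrightarrow> (\<exists>c. tiles L a c \<and> tiles M c b)"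
  by (induction L arbitrary: a) auto

lemma tiles_le: "tiles L a b \<Longrightarrow> a \<le> b"
  by (induction L arbitrary: a) force+

lemma tiles_less: "tiles L a b \<Longrightarrow> L \<noteq> [] \<Longrightarrow> a < b"
  by (cases L) (auto dest: tiles_le)

lemma tiles_mem:
  assumes "tiles L a b" "I \<in> set L"
  shows "a \<le> fst I" "fst I < snd I" "snd I \<le> b"
proof -
  obtain xs ys where "L = xs @ I # ys" using assms(2) by (meson split_list)
  then show "a \<le> fst I" "fst I < snd I" "snd I \<le> b"
    using assms(1) by (auto simp: tiles_append dest: tiles_le)
qed

lemma tiles_cover:
  assumes "tiles L a b" "L \<noteq> []" "x \<in> {a..b}"
  obtains I where "I \<in> set L" "x \<in> {fst I..snd I}"
proof -
  have "tiles L a b \<Longrightarrow> L \<noteq> [] \<Longrightarrow> x \<in> {a..b} \<Longrightarrow> \<exists>I\<in>set L. x \<in> {fst I..snd I}"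
  proof (induction L arbitrary: a)
    case (Cons I L)
    show ?case
    proof (cases "x \<le> snd I")
      case False
      with Cons.prems have "L \<noteq> []" "x \<in> {snd I..b}" "tiles L (snd I) b" by auto
      then show ?thesis using Cons.IH by auto
    qed (use Cons.prems in auto)
  qed simp
  with assms that show ?thesis by blast
qed

lemma maps_affinely_endpoints:
  assumes "maps_affinely f I J" "fst I < snd I"
  shows "f (fst I) = fst J" "f (snd I) = snd J"
  using assms by (auto simp: maps_affinely_def)

lemma maps_affinely_cong:
  assumes "\<And>x. x \<in> {fst I..snd I} \<Longrightarrow> f x = g x"
  shows "maps_affinely f I J \<longleftrightarrow> maps_affinely g I J"
  using assms by (auto simp: maps_affinely_def)

lemma maps_affinely_mem:
  assumes "maps_affinely f I J" "fst I < snd I" "fst J < snd J" "x \<in> {fst I..snd I}"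
  shows "f x \<in> {fst J..snd J}"
proof -
  have "0 \<le> (x - fst I) / (snd I - fst I)" "(x - fst I) / (snd I - fst I) \<le> 1"
    using assms by (auto simp: divide_simps)
  then have "0 \<le> (x - fst I) / (snd I - fst I) * (snd J - fst J)"
    "(x - fst I) / (snd I - fst I) * (snd J - fst J) \<le> 1 * (snd J - fst J)"
    using assms(3) by (intro mult_right_mono mult_nonneg_nonneg; simp)+
  moreover have "f x = fst J + (x - fst I) / (snd I - fst I) * (snd J - fst J)"
    using assms(1,4) by (simp add: maps_affinely_def)
  ultimately show ?thesis by auto
qed

lemma maps_affinely_comp:
  assumes "maps_affinely f I J" "maps_affinely g J K" "fst I < snd I" "fst J < snd J"
  shows "maps_affinely (\<lambda>x. g (f x)) I K"
  unfolding maps_affinely_def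
proof
  fix x assume x: "x \<in> {fst I..snd I}"
  have "f x \<in> {fst J..snd J}" using maps_affinely_mem assms x by blast
  moreover have "f x = fst J + (x - fst I) * ((snd J - fst J) / (snd I - fst I))"
    using assms(1) x by (simp add: maps_affinely_def)
  ultimately show "g (f x) = fst K + (x - fst I) * ((snd K - fst K) / (snd I - fst I))"
    using assms(2-4) by (simp add: maps_affinely_def)
qed

lemma maps_affinely_id: "fst I < snd I \<Longrightarrow> maps_affinely (\<lambda>x. x) I I"
  by (auto simp: maps_affinely_def)

lemma list_all2_maps_affinely_comp:
  assumes "list_all2 (maps_affinely f) L M" "list_all2 (maps_affinely g) M N"
    "tiles L a b" "tiles M c d"
  shows "list_all2 (maps_affinely (\<lambda>x. g (f x))) L N"
  using assms
proof (induction L M arbitrary: N a c rule: list_all2_induct)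
  case (Cons I L J M)
  then obtain K N' where "N = K # N'" "maps_affinely g J K" "list_all2 (maps_affinely g) M N'"
    by (auto simp: list_all2_Cons1)
  moreover have "maps_affinely (\<lambda>x. g (f x)) I K"
    using maps_affinely_comp Cons.hyps(1) \<open>maps_affinely g J K\<close> Cons.prems by auto
  ultimately show ?case using Cons.IH Cons.prems by auto
qed simp

lemma list_all2_maps_affinely_unique:
  assumes "list_all2 (maps_affinely f) L M" "list_all2 (maps_affinely g) L M"
    "tiles L a b" "L \<noteq> []" "x \<in> {a..b}"
  shows "f x = g x"
proof -
  obtain I where I: "I \<in> set L" "x \<in> {fst I..snd I}" using tiles_cover assms(3-5) by metis
  then obtain i where "i < length L" "I = L ! i" by (auto simp: in_set_conv_nth)
  then have "maps_affinely f I (M ! i)" "maps_affinely g I (M ! i)"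
    using assms(1,2) by (auto simp: list_all2_conv_all_nth)
  then show ?thesis using I(2) by (simp add: maps_affinely_def)
qed

section \<open>Piecewise linear maps determined by two subdivisions\<close>

fun pl_map :: "(real \<times> real) list \<Rightarrow> (real \<times> real) list \<Rightarrow> real \<Rightarrow> real" where
  "pl_map (I # L) (J # M) x =
     (if x \<le> snd I then fst J + (x - fst I) * ((snd J - fst J) / (snd I - fst I))
      else pl_map L M x)"
| "pl_map _ _ x = x"

lemma pl_map_left:
  assumes "tiles L a b" "tiles M c d" "length L = length M" "L \<noteq> []"
  shows "pl_map L M a = c"
  using assms by (cases L; cases M) auto

text \<open>At an endpoint shared by two intervals \<open>pl_map\<close> uses the left one. The
  right one gives the same value there, since the target intervals abut as well
  (\<open>pl_map_left\<close>).\<close>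

lemma pl_map_maps_affinely:
  assumes "tiles L a b" "tiles M c d" "length L = length M"
  shows "list_all2 (maps_affinely (pl_map L M)) L M"
proof -
  from assms(3) show ?thesis using assms(1,2)
  proof (induction L M arbitrary: a c rule: list_induct2)
    case (Cons I L J M)
    have t: "tiles L (snd I) b" "tiles M (snd J) d" using Cons.prems by auto
    have eq: "pl_map (I # L) (J # M) x = pl_map L M x" if "snd I \<le> x" "L \<noteq> []" for x
    proof (cases "x = snd I")
      case True
      then show ?thesis using pl_map_left[OF t Cons.hyps that(2)] Cons.prems by auto
    qed (use that in auto)
    have "list_all2 (maps_affinely (pl_map (I # L) (J # M))) L M"
    proof (rule list_all2_all_nthI)
      fix i assume i: "i < length L"
      then have "snd I \<le> fst (L ! i)" using tiles_mem(1)[OF t(1)] by simp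
      moreover have "maps_affinely (pl_map L M) (L ! i) (M ! i)"
        using Cons.IH[OF t] i by (simp add: list_all2_conv_all_nth)
      moreover have "L \<noteq> []" using i by auto
      ultimately show "maps_affinely (pl_map (I # L) (J # M)) (L ! i) (M ! i)"
        by (subst maps_affinely_cong[OF eq]) auto
    qed (use Cons.hyps in simp)
    moreover have "maps_affinely (pl_map (I # L) (J # M)) I J"
      by (simp add: maps_affinely_def)
    ultimately show ?case by (simp del: pl_map.simps)
  qed simp
qed

lemma strict_mono_on_join:
  fixes f :: "real \<Rightarrow> real"
  assumes "strict_mono_on {a..b} f" "strict_mono_on {b..c} f" "a \<le> b" "b \<le> c"
  shows "strict_mono_on {a..c} f"
proof (rule strict_mono_onI)
  fix r s assume *: "r \<in> {a..c}" "s \<in> {a..c}" "r < s"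
  consider "s \<le> b" | "b \<le> r" | "r < b" "b < s" using * by linarith
  then show "f r < f s"
  proof cases
    case 3
    then have "f r < f b" "f b < f s"
      using assms * by (auto simp: strict_mono_on_def)
    then show ?thesis by simp
  qed (use assms * in \<open>auto simp: strict_mono_on_def\<close>)
qed

lemma maps_affinely_strict_mono_on:
  assumes "maps_affinely f I J" "fst I < snd I" "fst J < snd J"
  shows "strict_mono_on {fst I..snd I} f"
proof (rule strict_mono_onI)
  fix x y assume "x \<in> {fst I..snd I}" "y \<in> {fst I..snd I}" "x < y"
  moreover have "(x - fst I) * ((snd J - fst J) / (snd I - fst I))
      < (y - fst I) * ((snd J - fst J) / (snd I - fst I))"
    using assms(2,3) \<open>x < y\<close> by (intro mult_strict_right_mono) auto
  ultimately show "f x < f y" using assms(1) unfolding maps_affinely_def by auto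
qed

lemma maps_affinely_continuous_on:
  assumes "maps_affinely f I J"
  shows "continuous_on {fst I..snd I} f"
proof -
  have "continuous_on {fst I..snd I} (\<lambda>x. fst J + (x - fst I) * ((snd J - fst J) / (snd I - fst I)))"
    by (intro continuous_intros)
  then show ?thesis
    by (rule continuous_on_eq) (use assms in \<open>simp add: maps_affinely_def\<close>)
qed

lemma pl_properties:
  assumes "list_all2 (maps_affinely f) L M" "tiles L a b" "tiles M c d" "L \<noteq> []"
  shows "f a = c \<and> f b = d \<and> strict_mono_on {a..b} f \<and> continuous_on {a..b} f"
  using assms
proof (induction L M arbitrary: a c rule: list_all2_induct)
  case (Cons I L J M)
  have I: "fst I = a" "a < snd I" "fst J = c" "c < snd J" and t: "tiles L (snd I) b" "tiles M (snd J) d"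
    using Cons.prems by auto
  have f: "f a = c" "f (snd I) = snd J" "strict_mono_on {a..snd I} f" "continuous_on {a..snd I} f"
    using maps_affinely_endpoints[OF Cons.hyps(1)] maps_affinely_strict_mono_on[OF Cons.hyps(1)]
      maps_affinely_continuous_on[OF Cons.hyps(1)] I by auto
  show ?case
  proof (cases "L = []")
    case True
    then have "M = []" using Cons.hyps(2) by simp
    then show ?thesis using f t True by simp
  next
    case False
    with Cons.IH[OF t] have *: "f b = d" "strict_mono_on {snd I..b} f" "continuous_on {snd I..b} f"
      by auto
    have le: "snd I \<le> b" using tiles_le t(1) by blast
    have "{a..snd I} \<union> {snd I..b} = {a..b}" using I le by auto
    then have "continuous_on {a..b} f"
      using continuous_on_closed_Un[OF _ _ f(4) *(3)] by simp
    then show ?thesis using f * I le strict_mono_on_join[OF f(3) *(2)] by simp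
  qed
qed simp

lemma pl_image:
  assumes "list_all2 (maps_affinely f) L M" "tiles L a b" "tiles M c d" "L \<noteq> []"
  shows "f ` {a..b} = {c..d}"
proof -
  note p = pl_properties[OF assms]
  have ab: "a \<le> b" using assms(2) tiles_le by blast
  have "f ` {a..b} \<subseteq> {c..d}"
  proof
    fix y assume "y \<in> f ` {a..b}"
    then obtain x where "x \<in> {a..b}" "y = f x" by auto
    moreover have "f a \<le> f x" "f x \<le> f b"
      using p \<open>x \<in> {a..b}\<close> ab strict_mono_on_leD[of "{a..b}" f] by auto
    ultimately show "y \<in> {c..d}" using p by auto
  qed
  moreover have "{c..d} \<subseteq> f ` {a..b}"
  proof
    fix y assume "y \<in> {c..d}"
    then have "\<exists>x\<ge>a. x \<le> b \<and> f x = y" using IVT'[of f a y b] p ab by auto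
    then show "y \<in> f ` {a..b}" by auto
  qed
  ultimately show ?thesis by blast
qed

text \<open>The restriction makes the map extensional, as the elements of \<open>BijGroup\<close>
  are.\<close>

definition pl_elem :: "(real \<times> real) list \<Rightarrow> (real \<times> real) list \<Rightarrow> real \<Rightarrow> real" where
  "pl_elem L M = restrict (pl_map L M) {0..1}"

lemma list_all2_maps_affinely_cong:
  assumes "tiles L 0 1" "\<And>x. x \<in> {0..1} \<Longrightarrow> f x = g x"
  shows "list_all2 (maps_affinely f) L M \<longleftrightarrow> list_all2 (maps_affinely g) L M"
proof (rule list.rel_cong)
  fix I J assume "I \<in> set L"
  from tiles_mem[OF assms(1) this] have "{fst I..snd I} \<subseteq> {0..1}" by auto
  then show "maps_affinely f I J \<longleftrightarrow> maps_affinely g I J"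
    using assms(2) by (intro maps_affinely_cong) auto
qed auto

lemma pl_elem_maps_affinely:
  assumes "tiles L 0 1" "tiles M 0 1" "length L = length M"
  shows "list_all2 (maps_affinely (pl_elem L M)) L M"
  by (rule iffD1[OF list_all2_maps_affinely_cong[OF assms(1)] pl_map_maps_affinely[OF assms]])
    (simp add: pl_elem_def)

text \<open>Reduces identities between elements, such as \<open>pl_elem_mult\<close>, to checking
  affinity interval by interval.\<close>

lemma pl_elem_unique:
  assumes "tiles L 0 1" "tiles M 0 1" "f \<in> extensional {0..1}" "list_all2 (maps_affinely f) L M"
  shows "f = pl_elem L M"
proof (rule extensionalityI[OF assms(3)])
  show "pl_elem L M \<in> extensional {0..1}" by (simp add: pl_elem_def)
  fix x :: real assume "x \<in> {0..1}"
  moreover have "L \<noteq> []" using assms(1) by auto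
  ultimately show "f x = pl_elem L M x"
    using list_all2_maps_affinely_unique[OF assms(4) pl_elem_maps_affinely]
      assms list_all2_lengthD by blast
qed

section \<open>Intervals of affinity and breakpoints\<close>

definition affine_on :: "(real \<Rightarrow> real) \<Rightarrow> real \<Rightarrow> real \<Rightarrow> bool" where
  "affine_on f a b \<longleftrightarrow> (\<exists>s t. \<forall>x\<in>{a..b}. f x = t + s * x)"

lemma affine_on_subset: "affine_on f a b \<Longrightarrow> a \<le> a' \<Longrightarrow> b' \<le> b \<Longrightarrow> affine_on f a' b'"
  unfolding affine_on_def by fastforce

lemma maps_affinely_affine_on:
  assumes "maps_affinely f I J"
  shows "affine_on f (fst I) (snd I)"
proof -
  let ?s = "(snd J - fst J) / (snd I - fst I)"
  have "f x = (fst J - fst I * ?s) + ?s * x" if "x \<in> {fst I..snd I}" for x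
  proof -
    have "f x = fst J + (x - fst I) * ?s" using assms that unfolding maps_affinely_def by blast
    then show ?thesis by (simp only:) (simp only: algebra_simps)
  qed
  then show ?thesis unfolding affine_on_def by blast
qed

lemma affine_on_maps_affinely:
  assumes "affine_on f a b" "a < b"
  shows "maps_affinely f (a, b) (f a, f b)"
proof -
  obtain s t where f: "\<And>x. x \<in> {a..b} \<Longrightarrow> f x = t + s * x"
    using assms(1) unfolding affine_on_def by blast
  have ends: "f a = t + s * a" "f b = t + s * b" using f[of a] f[of b] assms(2) by auto
  have "(f b - f a) / (b - a) = s" unfolding ends using assms(2) by (simp add: field_simps)
  then show ?thesis unfolding maps_affinely_def using f ends by (simp add: algebra_simps)
qed

lemma line_unique:
  fixes s t s' t' x y :: real
  assumes "t + s * x = t' + s' * x" "t + s * y = t' + s' * y" "x < y"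
  shows "s = s' \<and> t = t'"
proof -
  have "(s - s') * (y - x) = 0" using assms(1,2) by (simp add: algebra_simps)
  then have "s = s'" using assms(3) by simp
  then show ?thesis using assms(1) by simp
qed

text \<open>Around \<open>c\<close> the interval \<open>{u..v}\<close> meets both pieces in
  nondegenerate intervals. A line is determined by two points, so both pieces lie on the line
  belonging to \<open>{u..v}\<close>.\<close>

lemma affine_on_glue:
  assumes "affine_on f a c" "affine_on f c b" "affine_on f u v" "a < c" "c < b" "u < c" "c < v"
  shows "affine_on f a b"
proof -
  obtain s1 t1 where 1: "\<And>x. x \<in> {a..c} \<Longrightarrow> f x = t1 + s1 * x"
    using assms(1) unfolding affine_on_def by blast
  obtain s2 t2 where 2: "\<And>x. x \<in> {c..b} \<Longrightarrow> f x = t2 + s2 * x"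
    using assms(2) unfolding affine_on_def by blast
  obtain s t where 3: "\<And>x. x \<in> {u..v} \<Longrightarrow> f x = t + s * x"
    using assms(3) unfolding affine_on_def by blast
  define l where "l = max a u"
  define r where "r = min b v"
  have l: "l \<in> {a..c}" "l \<in> {u..v}" "l < c" and r: "r \<in> {c..b}" "r \<in> {u..v}" "c < r"
    using assms by (auto simp: l_def r_def)
  have c: "c \<in> {a..c}" "c \<in> {c..b}" "c \<in> {u..v}" using assms by auto
  have "s1 = s \<and> t1 = t"
    using 1[OF l(1)] 3[OF l(2)] 1[OF c(1)] 3[OF c(3)] l(3) by (intro line_unique[of _ _ l _ _ c]) auto
  moreover have "s2 = s \<and> t2 = t"
    using 2[OF r(1)] 3[OF r(2)] 2[OF c(2)] 3[OF c(3)] r(3) by (intro line_unique[of _ _ c _ _ r]) auto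
  ultimately have "f x = t + s * x" if "x \<in> {a..b}" for x
    using 1[of x] 2[of x] that by (cases "x \<le> c") auto
  then show ?thesis unfolding affine_on_def by blast
qed

text \<open>Meant for contrapositive use: a map affine on each tile but not on all of
  \<open>{a..b}\<close> has a genuine breakpoint at an inner endpoint, a point without any
  neighbourhood of affinity.\<close>

lemma affine_on_tiles:
  assumes "tiles M a b" "M \<noteq> []"
    and "\<And>I. I \<in> set M \<Longrightarrow> affine_on f (fst I) (snd I)"
    and "\<And>I. I \<in> set M \<Longrightarrow> snd I < b \<Longrightarrow> \<exists>u v. u < snd I \<and> snd I < v \<and> affine_on f u v"
  shows "affine_on f a b"
  using assms
proof (induction M arbitrary: a)
  case (Cons I M)
  show ?case
  proof (cases "M = []")
    case True
    then show ?thesis using Cons.prems(1) Cons.prems(3)[of I] by simp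
  next
    case False
    have t: "tiles M (snd I) b" "fst I = a" "a < snd I" using Cons.prems(1) by auto
    have lt: "snd I < b" using tiles_less t(1) False by blast
    have "affine_on f (snd I) b" using Cons.IH[OF t(1) False] Cons.prems by auto
    moreover have "affine_on f a (snd I)" using Cons.prems(3)[of I] t by simp
    moreover obtain u v where "u < snd I" "snd I < v" "affine_on f u v"
      using Cons.prems(4)[of I] lt by auto
    ultimately show ?thesis using affine_on_glue t(3) lt by blast
  qed
qed simp

lemma tiles_end_unique: "tiles L a b \<Longrightarrow> tiles L a b' \<Longrightarrow> b = b'"
  by (induction L arbitrary: a) auto

lemma maps_affinely_target_unique:
  assumes "maps_affinely f I J" "maps_affinely f I J'" "fst I < snd I"
  shows "J = J'"
  using maps_affinely_endpoints[OF assms(1,3)] maps_affinely_endpoints[OF assms(2,3)]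
  by (simp add: prod_eq_iff)

lemma list_all2_target_unique:
  assumes "list_all2 (maps_affinely f) L M" "list_all2 (maps_affinely f) L M'" "tiles L a b"
  shows "M = M'"
proof (rule nth_equalityI)
  show "length M = length M'" using assms(1,2) list_all2_lengthD by metis
  fix i assume "i < length M"
  then have i: "i < length L" using assms(1) list_all2_lengthD by metis
  show "M ! i = M' ! i"
    using list_all2_nthD[OF assms(1) i] list_all2_nthD[OF assms(2) i] tiles_mem(2)[OF assms(3)] i
    by (intro maps_affinely_target_unique) auto
qed

section \<open>Subdivisions and trees\<close>

text \<open>Phrased with \<open>child_intervals\<close> so that it agrees directly with the leaf
  intervals of a single caret.\<close>

definition pieces :: "nat \<Rightarrow> real \<times> real \<Rightarrow> (real \<times> real) list" where
  "pieces q I = child_intervals (replicate q Leaf) (fst I) ((snd I - fst I) / real q)"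

definition subdivide :: "(real \<times> real) list \<Rightarrow> nat \<Rightarrow> nat \<Rightarrow> (real \<times> real) list" where
  "subdivide L i q = take i L @ pieces q (L ! i) @ drop (Suc i) L"

lemma subdivide_append [simp]: "subdivide (A @ I # B) (length A) q = A @ pieces q I @ B"
  by (simp add: subdivide_def)

lemma subdivide_decomp:
  assumes "i < length L"
  obtains A I B where "L = A @ I # B" "length A = i" "subdivide L i q = A @ pieces q I @ B"
  using assms by (metis id_take_nth_drop length_take min.absorb4 subdivide_append)

lemma length_child_intervals_Leaf [simp]: "length (child_intervals (replicate q Leaf) a d) = q"
  by (induction q arbitrary: a) auto

lemma length_pieces [simp]: "length (pieces q I) = q"
  by (simp add: pieces_def)

lemma length_subdivide: "i < length L \<Longrightarrow> length (subdivide L i q) = length L - 1 + q"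
  by (simp add: subdivide_def)

lemma length_intervals:
  "length (leaf_intervals t a b) = leaves t"
  "length (child_intervals ts a d) = sum_list (map leaves ts)"
  by (induction t a b and ts a d rule: leaf_intervals_child_intervals.induct) auto

lemma tiles_child_intervals_Leaf:
  "0 < d \<Longrightarrow> tiles (child_intervals (replicate q Leaf) a d) a (a + real q * d)"
proof (induction q arbitrary: a)
  case (Suc q)
  from Suc.IH[of "a + d"] Suc.prems show ?case by (simp add: algebra_simps)
qed simp

lemma tiles_pieces:
  assumes "fst I < snd I" "0 < q"
  shows "tiles (pieces q I) (fst I) (snd I)"
  using tiles_child_intervals_Leaf[of "(snd I - fst I) / real q" q "fst I"] assms
  by (simp add: pieces_def)

lemma tiles_subdivide:
  assumes "tiles L a b" "i < length L" "0 < q"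
  shows "tiles (subdivide L i q) a b"
proof -
  obtain A I B where *: "L = A @ I # B" "subdivide L i q = A @ pieces q I @ B"
    using subdivide_decomp assms(2) by metis
  show ?thesis
    using assms(1) tiles_pieces[OF _ assms(3), of I] unfolding *(2) unfolding *(1)
    by (auto simp: tiles_append)
qed

text \<open>Splitting interval \<open>i\<close> into \<open>q\<close> parts moves the later interval
  \<open>i'\<close> to position \<open>i' + q - 1\<close>. Reading one subdivision in two orders is
  the source of the relations \<open>gen_stable_Suc\<close> and \<open>gen_shift\<close>.\<close>

lemma subdivide_commute:
  assumes "i < i'" "i' < length L" "0 < q"
  shows "subdivide (subdivide L i q) (i' + q - 1) q' = subdivide (subdivide L i' q') i q"
proof -
  obtain A I B where 1: "L = A @ I # B" "length A = i"
    using subdivide_decomp assms(1,2) by (metis dual_order.strict_trans)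
  moreover have "i' - Suc i < length B" using assms 1 by auto
  then obtain C J D where 2: "B = C @ J # D" "length C = i' - Suc i"
    using subdivide_decomp by metis
  have "subdivide L i q = (A @ pieces q I @ C) @ J # D"
    using subdivide_append[of A I "C @ J # D" q] 1 2 by simp
  moreover have "length (A @ pieces q I @ C) = i' + q - 1" using 1 2 assms by simp
  ultimately have a: "subdivide (subdivide L i q) (i' + q - 1) q' = (A @ pieces q I @ C) @ pieces q' J @ D"
    by (metis subdivide_append)
  have "subdivide L i' q' = subdivide ((A @ I # C) @ J # D) (length (A @ I # C)) q'"
    using 1 2 assms by simp
  also have "\<dots> = A @ I # (C @ pieces q' J @ D)" unfolding subdivide_append by simp
  finally have "subdivide (subdivide L i' q') i q = A @ pieces q I @ (C @ pieces q' J @ D)"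
    using 1(2) by (metis subdivide_append)
  with a show ?thesis by simp
qed

lemma list_all2_child_intervals_Leaf:
  assumes "\<And>x. x \<in> {a..a + real q * d} \<Longrightarrow> f x = c + (x - a) * (e / d)" "0 < d"
  shows "list_all2 (maps_affinely f) (child_intervals (replicate q Leaf) a d)
    (child_intervals (replicate q Leaf) c e)"
  using assms(1)
proof (induction q arbitrary: a c)
  case (Suc q)
  have 1: "maps_affinely f (a, a + d) (c, c + e)"
    unfolding maps_affinely_def
  proof
    fix x assume x: "x \<in> {fst (a, a + d)..snd (a, a + d)}"
    have "a + d \<le> a + real (Suc q) * d" using assms(2) by (simp add: algebra_simps)
    then have "x \<in> {a..a + real (Suc q) * d}" using x by (auto simp del: of_nat_Suc)
    from Suc.prems[OF this]
    show "f x = fst (c, c + e) + (x - fst (a, a + d)) *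
        ((snd (c, c + e) - fst (c, c + e)) / (snd (a, a + d) - fst (a, a + d)))" by simp
  qed
  have 2: "list_all2 (maps_affinely f) (child_intervals (replicate q Leaf) (a + d) d)
      (child_intervals (replicate q Leaf) (c + e) e)"
  proof (rule Suc.IH)
    fix x assume "x \<in> {a + d..a + d + real q * d}"
    then have "x \<in> {a..a + real (Suc q) * d}" using assms(2) by (auto simp: algebra_simps)
    from Suc.prems[OF this] show "f x = c + e + (x - (a + d)) * (e / d)"
      using assms(2) by (simp add: field_simps)
  qed
  from 1 2 show ?case by simp
qed simp

lemma list_all2_pieces:
  assumes "maps_affinely f I J" "fst I < snd I" "0 < q"
  shows "list_all2 (maps_affinely f) (pieces q I) (pieces q J)"
  unfolding pieces_def
proof (rule list_all2_child_intervals_Leaf)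
  fix x assume "x \<in> {fst I..fst I + real q * ((snd I - fst I) / real q)}"
  then have "x \<in> {fst I..snd I}" using assms(3) by simp
  then show "f x = fst J + (x - fst I) * ((snd J - fst J) / real q / ((snd I - fst I) / real q))"
    using assms(1,3) by (simp add: maps_affinely_def)
qed (use assms in simp)

lemma list_all2_subdivide:
  assumes "list_all2 (maps_affinely f) L M" "tiles L a b" "i < length L" "0 < q"
  shows "list_all2 (maps_affinely f) (subdivide L i q) (subdivide M i q)"
proof -
  have "length L = length M" using assms(1) by (rule list_all2_lengthD)
  moreover have "maps_affinely f (L ! i) (M ! i)" using list_all2_nthD[OF assms(1,3)] .
  moreover have "fst (L ! i) < snd (L ! i)" using tiles_mem(2) assms(2,3) nth_mem by blast
  ultimately show ?thesis
    using assms unfolding subdivide_def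
    by (intro list_all2_appendI list_all2_takeI list_all2_dropI list_all2_pieces) auto
qed

lemma mem_child_intervals_Leaf:
  "J \<in> set (child_intervals (replicate q Leaf) a d) \<Longrightarrow>
     \<exists>i<q. fst J = a + real i * d \<and> snd J = a + real (Suc i) * d"
proof (induction q arbitrary: a)
  case (Suc q)
  show ?case
  proof (cases "J = (a, a + d)")
    case False
    with Suc.prems have "J \<in> set (child_intervals (replicate q Leaf) (a + d) d)" by simp
    from Suc.IH[OF this] obtain i where
      "i < q" "fst J = a + d + real i * d" "snd J = a + d + real (Suc i) * d" by blast
    then show ?thesis by (intro exI[of _ "Suc i"]) (simp add: algebra_simps)
  qed (use Suc.prems in auto)
qed simp

lemma mem_pieces:
  assumes "J \<in> set (pieces q I)"
  obtains i where "fst J = fst I + real i * ((snd I - fst I) / real q)"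
    "snd J = fst I + real (Suc i) * ((snd I - fst I) / real q)"
    "snd J - fst J = (snd I - fst I) / real q"
proof -
  obtain i where "fst J = fst I + real i * ((snd I - fst I) / real q)"
    "snd J = fst I + real (Suc i) * ((snd I - fst I) / real q)"
    using mem_child_intervals_Leaf assms unfolding pieces_def by blast
  moreover from this have "snd J - fst J = (snd I - fst I) / real q"
    by (simp only: of_nat_Suc distrib_right)
  ultimately show thesis using that by blast
qed

lemma set_subdivide_subset: "set (subdivide L i q) \<subseteq> set L \<union> set (pieces q (L ! i))"
  by (auto simp: subdivide_def dest: in_set_takeD in_set_dropD)

section \<open>Attaching carets to trees\<close>

text \<open>The dictionary between trees and lists of intervals. The claim on lengths is carried
  along because the width of a child interval depends on the number of children.\<close>

lemma intervals_graft_caret: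
  "i < leaves t \<Longrightarrow> leaf_intervals (graft t i (single_caret q)) a b = subdivide (leaf_intervals t a b) i q"
  "i < sum_list (map leaves ts) \<Longrightarrow>
     child_intervals (graft_list ts i (single_caret q)) a d = subdivide (child_intervals ts a d) i q
     \<and> length (graft_list ts i (single_caret q)) = length ts"
proof (induction t a b and ts a d arbitrary: i and i rule: leaf_intervals_child_intervals.induct)
  case (1 a b)
  then show ?case by (simp add: single_caret_def subdivide_def pieces_def)
next
  case (4 t ts a d)
  show ?case
  proof (cases "i < leaves t")
    case True
    then show ?thesis using "4.IH"(1)[OF True]
      by (simp add: subdivide_def length_intervals nth_append)
  next
    case False
    then have "i - leaves t < sum_list (map leaves ts)" using "4.prems" by auto
    then show ?thesis using "4.IH"(2) False
      by (simp add: subdivide_def length_intervals nth_append Suc_diff_le)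
  qed
qed auto

lemma ary_tree_graft:
  "ary_tree S t \<Longrightarrow> ary_tree S u \<Longrightarrow> ary_tree S (graft t i u)"
  "\<forall>t\<in>set ts. ary_tree S t \<Longrightarrow> ary_tree S u \<Longrightarrow>
     (\<forall>t\<in>set (graft_list ts i u). ary_tree S t) \<and> length (graft_list ts i u) = length ts"
  by (induction t i u and ts i u rule: graft_graft_list.induct) auto

lemma ary_tree_single_caret: "q \<in> S \<Longrightarrow> ary_tree S (single_caret q)"
  by (simp add: single_caret_def)

lemma ary_tree_right_string: "0 < p \<Longrightarrow> p \<in> S \<Longrightarrow> ary_tree S (right_string p m)"
  by (induction m) auto

lemma leaves_right_string: "leaves (right_string p m) = m * (p - 1) + 1"
  by (induction m) (auto simp: sum_list_replicate)

lemma graft_list_replicate_Leaf: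
  "i < leaves t \<Longrightarrow> graft_list (replicate r Leaf @ [t]) (r + i) u = replicate r Leaf @ [graft t i u]"
  by (induction r) auto

text \<open>\<open>right_string\<close> recurses at the root, whereas the list of intervals grows at
  the last leaf, whose number is \<open>m * (p - 1)\<close>.\<close>

lemma right_string_Suc_graft:
  assumes "0 < p"
  shows "right_string p (Suc m) = graft (right_string p m) (m * (p - 1)) (single_caret p)"
proof (induction m)
  case 0
  have "replicate p Leaf = replicate (Suc (p - 1)) Leaf" using assms by simp
  also have "\<dots> = replicate (p - 1) Leaf @ [Leaf]" by (metis replicate_Suc replicate_append_same)
  finally show ?case by (simp add: single_caret_def)
next
  case (Suc m)
  have "graft (right_string p (Suc m)) (Suc m * (p - 1)) (single_caret p)
      = Caret (replicate (p - 1) Leaf @ [graft (right_string p m) (m * (p - 1)) (single_caret p)])"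
    using graft_list_replicate_Leaf[of "m * (p - 1)" "right_string p m" "p - 1"]
    by (simp add: leaves_right_string)
  also have "\<dots> = right_string p (Suc (Suc m))" unfolding Suc.IH[symmetric] by simp
  finally show ?case by simp
qed

text \<open>Grows \<open>t\<close> caret by caret in preorder; the second argument of \<open>P\<close> bounds the leaf number of
  the last caret attached.\<close>

lemma tree_growth_induct:
  assumes "ary_tree S t" "P (A @ (a, b) # B) (length A)"
    and step: "\<And>L i q. P L i \<Longrightarrow> i < length L \<Longrightarrow> q \<in> S \<Longrightarrow> P (subdivide L i q) i"
    and mono: "\<And>L i i'. P L i \<Longrightarrow> i \<le> i' \<Longrightarrow> P L i'"
  shows "P (A @ leaf_intervals t a b @ B) (length A + leaves t)"
proof -
  \<comment> \<open>The companion claim starts from a parent already split into one leaf per child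
    and grows the children from left to right.\<close>
  have "ary_tree S t \<Longrightarrow> P (A @ (a, b) # B) (length A) \<Longrightarrow>
      P (A @ leaf_intervals t a b @ B) (length A + leaves t)"
    and "\<forall>t\<in>set ts. ary_tree S t \<Longrightarrow>
      P (A @ child_intervals (replicate (length ts) Leaf) a d @ B) (length A) \<Longrightarrow>
      P (A @ child_intervals ts a d @ B) (length A + sum_list (map leaves ts))" for ts d
  proof (induction t a b and ts a d arbitrary: A B and A B
      rule: leaf_intervals_child_intervals.induct)
    case (1 a b)
    then show ?case using mono[of _ "length A" "length A + 1"] by simp
  next
    case (2 ts a b)
    from step[OF "2.prems"(2), of "length ts"]
    have "P (A @ child_intervals (replicate (length ts) Leaf) a ((b - a) / real (length ts)) @ B) (length A)"
      using "2.prems"(1) by (simp add: pieces_def)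
    then show ?case using "2.IH" "2.prems" by simp
  next
    case (4 t ts a d)
    have "P (A @ leaf_intervals t a (a + d) @ child_intervals (replicate (length ts) Leaf) (a + d) d @ B)
        (length A + leaves t)"
      using "4.prems" by (intro "4.IH"(1)) auto
    then have "P ((A @ leaf_intervals t a (a + d)) @ child_intervals ts (a + d) d @ B)
        (length (A @ leaf_intervals t a (a + d)) + sum_list (map leaves ts))"
      using "4.prems" by (intro "4.IH"(2)) (auto simp: length_intervals)
    then show ?case by (simp add: length_intervals add.assoc)
  qed simp_all
  then show ?thesis using assms(1,2) by blast
qed

section \<open>A divisibility bound\<close>

lemma multiplicity_le_self:
  fixes x q :: nat
  assumes "prime q" "0 < x"
  shows "multiplicity q x \<le> x"
proof -
  have "q ^ multiplicity q x \<le> x" using multiplicity_dvd assms(2) by (intro dvd_imp_le) auto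
  moreover have "multiplicity q x < q ^ multiplicity q x"
    using prime_gt_Suc_0_nat[OF assms(1)] by (rule power_gt_expt)
  ultimately show ?thesis by simp
qed

text \<open>Compare the multiplicities of one prime factor \<open>q\<close> of \<open>p\<close>.
  Those of \<open>r\<close> and \<open>Q\<close> are bounded crudely by the numbers
  themselves.\<close>

lemma exponent_bound:
  fixes p r Q :: nat
  assumes "2 \<le> p" "0 < r" "0 < Q" "p ^ l dvd r * Q ^ s"
  shows "l \<le> r + s * Q"
proof -
  obtain q where q: "prime q" "q dvd p" using prime_factor_nat[of p] assms(1) by auto
  then have "q ^ l dvd r * Q ^ s" using assms(4) dvd_power_same dvd_trans by blast
  then have "l \<le> multiplicity q (r * Q ^ s)"
    using assms(2,3) q(1) by (intro multiplicity_geI) auto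
  also have "\<dots> = multiplicity q r + s * multiplicity q Q"
    using assms(2,3) q(1) by (simp add: prime_elem_multiplicity_mult_distrib prime_elem_multiplicity_power_distrib)
  also have "\<dots> \<le> r + s * Q"
    using multiplicity_le_self[OF q(1)] assms(2,3) by (intro add_mono mult_le_mono) auto
  finally show ?thesis .
qed

section \<open>Removing the last caret of a tree\<close>

lemma child_intervals_append:
  "child_intervals (ts @ us) a d
     = child_intervals ts a d @ child_intervals us (a + real (length ts) * d) d"
  by (induction ts arbitrary: a) (auto simp: algebra_simps)

text \<open>Arity 0 is excluded because a caret without children would cover nothing.\<close>

lemma tiles_intervals:
  assumes "0 \<notin> S"
  shows "ary_tree S t \<Longrightarrow> a < b \<Longrightarrow> tiles (leaf_intervals t a b) a b"
    and "\<forall>t\<in>set ts. ary_tree S t \<Longrightarrow> 0 < d \<Longrightarrow>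
      tiles (child_intervals ts a d) a (a + real (length ts) * d)"
proof (induction t a b and ts a d rule: leaf_intervals_child_intervals.induct)
  case (2 ts a b)
  then have "0 < length ts" using assms by (metis ary_tree.simps(2) gr0I)
  with 2 show ?case by simp
next
  case (4 t ts a d)
  have eq: "a + real (length (t # ts)) * d = (a + d) + real (length ts) * d"
    by (simp add: algebra_simps)
  have "tiles (leaf_intervals t a (a + d)) a (a + d)" using 4 by simp
  moreover have "tiles (child_intervals ts (a + d) d) (a + d) ((a + d) + real (length ts) * d)"
    using 4 by simp
  ultimately show ?case unfolding child_intervals.simps tiles_append eq by blast
qed auto

lemma child_interval_length_le:
  assumes "0 \<notin> S" "\<forall>t\<in>set ts. ary_tree S t" "0 < d" "I \<in> set (child_intervals ts a d)"
  shows "snd I - fst I \<le> d"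
  using assms(2,4)
proof (induction ts arbitrary: a)
  case (Cons t ts)
  have "tiles (leaf_intervals t a (a + d)) a (a + d)"
    using tiles_intervals(1) assms(1,3) Cons.prems by simp
  note leaf = tiles_mem[OF this, of I]
  consider "I \<in> set (leaf_intervals t a (a + d))" | "I \<in> set (child_intervals ts (a + d) d)"
    using Cons.prems(2) by auto
  then show ?case
  proof cases
    case 1
    then show ?thesis using leaf by simp
  next
    case 2
    then show ?thesis using Cons.IH Cons.prems(1) by simp
  qed
qed simp

lemma leaves_pos: "0 \<notin> S \<Longrightarrow> ary_tree S t \<Longrightarrow> 1 \<le> leaves t"
  using tiles_intervals(1)[of S t 0 1] length_intervals(1)[of t 0 1]
  by (cases "leaf_intervals t 0 1") auto

lemma length_le_leaves:
  assumes "0 \<notin> S" "\<forall>t\<in>set ts. ary_tree S t"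
  shows "length ts \<le> leaves (Caret ts)"
  using assms(2)
proof (induction ts)
  case (Cons t ts)
  then show ?case using leaves_pos[OF assms(1), of t] by simp
qed simp

lemma pieces_interval_length:
  "I \<in> set (pieces q J) \<Longrightarrow> snd I - fst I = (snd J - fst J) / real q"
  by (rule mem_pieces)

text \<open>A block of \<open>p\<close> equal leaf intervals at the right end must be a caret: the parent of the last
  leaf has at least \<open>p\<close> children, all of that length, and the leaf before the block is too long
  to be another one.\<close>

lemma remove_last_caret:
  assumes S: "\<forall>q\<in>S. p \<le> q" "2 \<le> p"
  shows "ary_tree S T \<Longrightarrow> a < b \<Longrightarrow> c < b \<Longrightarrow> leaf_intervals T a b = A @ pieces p (c, b) \<Longrightarrow>
    (A \<noteq> [] \<Longrightarrow> (b - c) / real p < snd (last A) - fst (last A)) \<Longrightarrow>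
    \<exists>T'. ary_tree S T' \<and> leaf_intervals T' a b = A @ [(c, b)]"
proof (induction T arbitrary: a A)
  case Leaf
  from arg_cong[OF Leaf.prems(4), of length] show ?case using S(2) by simp
next
  case (Caret ts)
  have S0: "0 \<notin> S" using S by force
  have ts: "length ts \<in> S" "\<forall>t\<in>set ts. ary_tree S t" using Caret.prems by auto
  have "ts \<noteq> []" using ts(1) S0 by auto
  then obtain us t where us: "ts = us @ [t]" by (metis rev_exhaust)
  define d where "d = (b - a) / real (length ts)"
  define a' where "a' = a + real (length us) * d"
  have d: "0 < d" using Caret.prems \<open>ts \<noteq> []\<close> by (simp add: d_def)
  have "real (length ts) * d = b - a" using \<open>ts \<noteq> []\<close> by (simp add: d_def)
  then have b: "a' + d = b" by (simp add: a'_def us algebra_simps)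
  have list: "leaf_intervals (Caret us') a b = child_intervals us' a d" if "length us' = length ts" for us'
    using that by (simp add: d_def)
  have eq: "child_intervals us a d @ leaf_intervals t a' b = A @ pieces p (c, b)"
    using Caret.prems(4) list[of ts] by (simp add: us child_intervals_append a'_def[symmetric] b)
  show ?case
  proof (cases t)
    case Leaf
    \<comment> \<open>The last leaf is a child of this caret and belongs to the block, so
      \<open>d\<close> is the width of a block piece. An interval before the block would be at most
      \<open>d\<close> wide, against the assumption on \<open>last A\<close>.\<close>
    have "pieces p (c, b) \<noteq> []" using S(2) by (metis length_pieces list.size(3) not_numeral_le_zero)
    then have "(a', b) \<in> set (pieces p (c, b))"
      using arg_cong[OF eq, of last] Leaf by (metis last_appendR last_in_set last_snoc leaf_intervals.simps(1))
    from pieces_interval_length[OF this] have d': "d = (b - c) / real p" using b by simp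
    have "A = []"
    proof (rule ccontr)
      assume "A \<noteq> []"
      then have "last A \<in> set (leaf_intervals (Caret ts) a b)" using Caret.prems(4) by simp
      then have "snd (last A) - fst (last A) \<le> d"
        using child_interval_length_le[OF S0 ts(2) d] list by simp
      then show False using Caret.prems(5)[OF \<open>A \<noteq> []\<close>] d' by simp
    qed
    then have "leaf_intervals (Caret ts) a b = pieces p (c, b)" using Caret.prems(4) by simp
    moreover have "tiles (leaf_intervals (Caret ts) a b) a b"
      using tiles_intervals(1)[OF S0 Caret.prems(1,2)] .
    moreover have "tiles (pieces p (c, b)) c b" using tiles_pieces[of "(c, b)" p] Caret.prems S by simp
    ultimately have "a = c" using \<open>pieces p (c, b) \<noteq> []\<close> by (cases "pieces p (c, b)") auto
    then show ?thesis using \<open>A = []\<close> by (intro exI[of _ Leaf]) simp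
  next
    case t: (Caret vs)
    have tS: "ary_tree S t" using ts us by simp
    then have "length vs \<in> S" "\<forall>v\<in>set vs. ary_tree S v" using t by auto
    then have "p \<le> length (leaf_intervals t a' b)"
      using S(1) length_le_leaves[OF S0, of vs] t by (auto simp: length_intervals)
    then have len: "length (child_intervals us a d) \<le> length A"
      using arg_cong[OF eq, of length] by simp
    \<comment> \<open>Since \<open>t\<close> has at least \<open>p\<close> leaves, the block lies
      inside \<open>t\<close>; \<open>A'\<close> is what precedes it there.\<close>
    define A' where "A' = drop (length (child_intervals us a d)) A"
    have A'1: "leaf_intervals t a' b = A' @ pieces p (c, b)"
      using arg_cong[OF eq, of "drop (length (child_intervals us a d))"] len by (simp add: A'_def)
    have "child_intervals us a d = take (length (child_intervals us a d)) A"
      using arg_cong[OF eq, of "take (length (child_intervals us a d))"] len by simp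
    then have A'2: "A = child_intervals us a d @ A'"
      unfolding A'_def by (metis append_take_drop_id)
    note A' = A'1 A'2
    have "\<exists>T'. ary_tree S T' \<and> leaf_intervals T' a' b = A' @ [(c, b)]"
    proof (rule Caret.IH)
      show "(b - c) / real p < snd (last A') - fst (last A')" if "A' \<noteq> []"
        using Caret.prems(5) that A'(2) by simp
    qed (use us tS b d Caret.prems(3) A'(1) in auto)
    then obtain T' where T': "ary_tree S T'" "leaf_intervals T' a' b = A' @ [(c, b)]" by blast
    have "leaf_intervals (Caret (us @ [T'])) a b = A @ [(c, b)]"
      using T' A' by (simp add: list us child_intervals_append a'_def[symmetric] b del: leaf_intervals.simps)
    moreover have "ary_tree S (Caret (us @ [T']))" using ts us T' by simp
    ultimately show ?thesis by blast
  qed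
qed

section \<open>Words in a monoid\<close>

lemma (in monoid) foldr_mult_closed:
  "set us \<subseteq> carrier G \<Longrightarrow> foldr (mult G) us \<one> \<in> carrier G"
  by (induction us) auto

lemma (in monoid) foldr_mult_append:
  "set us \<subseteq> carrier G \<Longrightarrow> set vs \<subseteq> carrier G \<Longrightarrow>
     foldr (mult G) (us @ vs) \<one> = foldr (mult G) us \<one> \<otimes> foldr (mult G) vs \<one>"
  by (induction us) (auto simp: foldr_mult_closed m_assoc)

text \<open>The simplifier rewrites \<open>foldr\<close> over a constant list to an iterate; this
  turns the iterate into a power.\<close>

lemma (in monoid) funpow_mult_one: "x \<in> carrier G \<Longrightarrow> ((\<otimes>) x ^^ r) \<one> = x [^] r"
  by (induction r) (simp, metis comp_apply funpow.simps(2) nat_pow_Suc2)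

section \<open>Elements given by pairs of subdivisions\<close>

locale thompson_stein_data =
  fixes k :: nat and n :: "nat \<Rightarrow> nat"
  assumes k_pos: "1 \<le> k"
    and arity_ge_2: "\<And>j. j \<in> {1..k} \<Longrightarrow> 2 \<le> n j"
    and dvd_arity: "\<And>j. j \<in> {1..k} \<Longrightarrow> n 1 - 1 dvd n j - 1"
begin

abbreviation p :: nat where "p \<equiv> n 1"

definition N :: nat where "N = (\<Prod>j\<in>{1..k}. n j)"

lemma p_ge_2: "2 \<le> p"
  using arity_ge_2 k_pos by simp

lemma one_in [simp]: "1 \<in> {1..k}" "Suc 0 \<in> {1..k}" "Suc 0 \<le> k"
  using k_pos by auto

lemma p_le_arity: "j \<in> {1..k} \<Longrightarrow> p \<le> n j"
  using dvd_imp_le[OF dvd_arity[of j]] arity_ge_2[of j] by simp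

lemma N_pos: "0 < N"
  unfolding N_def using arity_ge_2 by (force intro!: prod_pos)

lemma arity_dvd_N: "j \<in> {1..k} \<Longrightarrow> n j dvd N"
  unfolding N_def by (rule dvd_prodI) auto

lemma one_slope_group: "1 \<in> slope_group k n"
  unfolding slope_group_def by (auto intro!: exI[of _ "\<lambda>_. 0"])

lemma slope_group_divide:
  assumes "x \<in> slope_group k n" "y \<in> slope_group k n"
  shows "x / y \<in> slope_group k n"
proof -
  obtain e e' where "x = (\<Prod>j\<in>{1..k}. real (n j) powi e j)" "y = (\<Prod>j\<in>{1..k}. real (n j) powi e' j)"
    using assms unfolding slope_group_def by blast
  moreover have "(\<Prod>j\<in>{1..k}. real (n j) powi (e j - e' j))
      = (\<Prod>j\<in>{1..k}. real (n j) powi e j / real (n j) powi e' j)"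
    by (rule prod.cong) (use arity_ge_2 in \<open>force intro!: power_int_diff\<close>)+
  ultimately have "x / y = (\<Prod>j\<in>{1..k}. real (n j) powi (e j - e' j))"
    by (simp add: prod_dividef)
  then show ?thesis unfolding slope_group_def
    by (intro CollectI exI[of _ "\<lambda>j. e j - e' j"]) simp
qed

lemma arity_slope_group:
  assumes "j \<in> {1..k}"
  shows "real (n j) \<in> slope_group k n"
proof -
  have "(\<Prod>i\<in>{1..k}. real (n i) powi (if i = j then 1 else 0))
      = (\<Prod>i\<in>{1..k}. if i = j then real (n i) else 1)"
    by (rule prod.cong) auto
  also have "\<dots> = real (n j)" using assms by (simp add: prod.delta)
  finally show ?thesis unfolding slope_group_def
    by (intro CollectI exI[of _ "\<lambda>i. if i = j then 1 else 0"]) simp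
qed

section \<open>Subdivisions with admissible arities\<close>

text \<open>Covers the lists of leaf intervals of admissible trees
  (\<open>subdivision_leaf_intervals\<close>). One step adds one caret, so invariants can be proved
  by induction without mentioning trees.\<close>

inductive subdivision :: "(real \<times> real) list \<Rightarrow> bool" where
  base: "subdivision [(0, 1)]"
| step: "subdivision L \<Longrightarrow> i < length L \<Longrightarrow> j \<in> {1..k} \<Longrightarrow> subdivision (subdivide L i (n j))"

lemma subdivision_tiles: "subdivision L \<Longrightarrow> tiles L 0 1"
  by (induction rule: subdivision.induct) (use arity_ge_2 in \<open>force intro!: tiles_subdivide\<close>)+

lemma subdivision_not_Nil: "subdivision L \<Longrightarrow> L \<noteq> []"
  using subdivision_tiles by fastforce

text \<open>A caret of type \<open>n j\<close> adds \<open>n j - 1\<close> leaves, a multiple of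
  \<open>p - 1\<close>. Hence some right string has the same number of leaves.\<close>

lemma subdivision_length: "subdivision L \<Longrightarrow> p - 1 dvd length L - 1"
proof (induction rule: subdivision.induct)
  case (step L i j)
  have "length (subdivide L i (n j)) - 1 = (length L - 1) + (n j - 1)"
    using step.hyps arity_ge_2[of j] by (simp add: length_subdivide)
  then show ?case using step dvd_arity by (metis dvd_add)
qed simp

lemma subdivision_slope:
  "subdivision L \<Longrightarrow> I \<in> set L \<Longrightarrow> snd I - fst I \<in> slope_group k n"
proof (induction arbitrary: I rule: subdivision.induct)
  case (step L i j)
  then consider "I \<in> set L" | "I \<in> set (pieces (n j) (L ! i))"
    using set_subdivide_subset by blast
  then show ?case
  proof cases
    case 2
    then show ?thesis
      using step slope_group_divide arity_slope_group by (metis mem_pieces nth_mem)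
  qed (use step in auto)
qed (simp add: one_slope_group)

text \<open>A step costs one factor \<open>N\<close>, as \<open>n j\<close> divides
  \<open>N\<close>, and lengthens the list by at least 1, as \<open>n j\<close> is at least 2. So
  the length can serve as the exponent.\<close>

lemma subdivision_grid:
  "subdivision L \<Longrightarrow> I \<in> set L \<Longrightarrow>
     fst I * real N ^ length L \<in> \<int> \<and> snd I * real N ^ length L \<in> \<int>"
proof (induction arbitrary: I rule: subdivision.induct)
  case (step L i j)
  obtain M where M: "N = n j * M" using arity_dvd_N step.hyps by blast
  have pos: "0 < n j" using arity_ge_2[of j] step.hyps by simp
  \<comment> \<open>The surplus \<open>n j - 2\<close> of the new length over the single extra
    factor \<open>N\<close> that is required.\<close>
  define l where "l = length (subdivide L i (n j)) - Suc (length L)"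
  have len: "length (subdivide L i (n j)) = Suc (length L) + l"
    unfolding l_def using step.hyps arity_ge_2[of j] by (simp add: length_subdivide)
  have lift: "x * real N ^ (Suc (length L) + l) \<in> \<int>" if "x * real N * real N ^ length L \<in> \<int>" for x
  proof -
    have "x * real N ^ (Suc (length L) + l) = x * real N * real N ^ length L * real (N ^ l)"
      by (simp add: power_add)
    then show ?thesis using that by (metis Ints_mult Ints_of_nat)
  qed
  have lift': "x * real N ^ (Suc (length L) + l) \<in> \<int>" if "x * real N ^ length L \<in> \<int>" for x
    using that Ints_mult[OF that Ints_of_nat, of N] by (intro lift) (simp add: ac_simps)
  consider "I \<in> set L" | "I \<in> set (pieces (n j) (L ! i))"
    using step.prems set_subdivide_subset by blast
  then show ?case
  proof cases
    case 1
    then show ?thesis unfolding len using step.IH lift' by blast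
  next
    case 2
    define J where "J = L ! i"
    have J: "fst J * real N ^ length L \<in> \<int>" "snd J * real N ^ length L \<in> \<int>"
      using step unfolding J_def by auto
    have "(fst J + real r * ((snd J - fst J) / real (n j))) * real N * real N ^ length L \<in> \<int>" for r
    proof -
      have "(fst J + real r * ((snd J - fst J) / real (n j))) * real N * real N ^ length L
          = real N * (fst J * real N ^ length L)
            + real (r * M) * (snd J * real N ^ length L - fst J * real N ^ length L)"
        using pos by (simp add: M field_simps)
      then show ?thesis using J by (metis Ints_add Ints_diff Ints_mult Ints_of_nat)
    qed
    then show ?thesis using 2 lift unfolding len J_def by (metis mem_pieces)
  qed
qed simp

lemma subdivision_Zinv:
  assumes "subdivision L" "I \<in> set L"
  shows "fst I \<in> Zinv N" "snd I \<in> Zinv N"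
proof -
  have "x \<in> Zinv N" if int: "x * real N ^ l \<in> \<int>" for x l
  proof -
    obtain a where "x * real N ^ l = of_int a" using int by (rule Ints_cases)
    then have "x = of_int a / of_nat N ^ l" using N_pos by (simp add: field_simps)
    then show ?thesis unfolding Zinv_def by blast
  qed
  then show "fst I \<in> Zinv N" "snd I \<in> Zinv N" using subdivision_grid[OF assms] by (meson)+
qed

section \<open>Elements of the group\<close>

abbreviation H where "H \<equiv> BijGroup {0..1::real}"
abbreviation G where "G \<equiv> thompson_stein k n"

lemma carrier_H: "carrier H = Bij {0..1}" and mult_H: "x \<in> Bij {0..1} \<Longrightarrow> y \<in> Bij {0..1} \<Longrightarrow> x \<otimes>\<^bsub>H\<^esub> y = compose {0..1} x y"
  and one_H: "\<one>\<^bsub>H\<^esub> = (\<lambda>x\<in>{0..1}. x)"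
  by (simp_all add: BijGroup_def)

lemma mult_G [simp]: "mult G = mult H" and one_G [simp]: "one G = one H"
  by (simp_all add: thompson_stein_def)

lemma carrier_G_subset: "carrier G \<subseteq> carrier H"
  by (auto simp: thompson_stein_def carrier_H)

lemma pl_elem_carrier:
  assumes "subdivision L" "subdivision M" "length L = length M"
  shows "pl_elem L M \<in> carrier G"
proof -
  let ?f = "pl_elem L M"
  have tL: "tiles L 0 1" and tM: "tiles M 0 1" using assms subdivision_tiles by auto
  have ne: "L \<noteq> []" using assms subdivision_not_Nil by auto
  have af: "list_all2 (maps_affinely ?f) L M" using pl_elem_maps_affinely tL tM assms(3) .
  note pr = pl_properties[OF af tL tM ne] and im = pl_image[OF af tL tM ne]
  have inj: "inj_on ?f {0..1}" using pr strict_mono_on_imp_inj_on by blast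
  have "?f \<in> Bij {0..1}"
    using inj im by (simp add: Bij_def bij_betw_def pl_elem_def)
  moreover have "\<exists>g. homeomorphism {0..1} {0..1} ?f g"
    using homeomorphism_compact[of "{0..1}" ?f "{0..1}"] pr im inj by simp
  moreover have "\<exists>B. finite B \<and> B \<subseteq> Zinv N \<and>
      (\<forall>a b. 0 \<le> a \<and> a < b \<and> b \<le> 1 \<and> {a<..<b} \<inter> B = {} \<longrightarrow>
        (\<exists>s\<in>slope_group k n. \<forall>x\<in>{a..b}. ?f x = ?f a + s * (x - a)))"
  \<comment> \<open>All endpoints of domain intervals serve as \<open>B\<close>. An interval that
    avoids them lies inside one tile, namely a tile containing its midpoint.\<close>
  proof (intro exI[of _ "fst ` set L \<union> snd ` set L"] conjI allI impI)
    show "fst ` set L \<union> snd ` set L \<subseteq> Zinv N" using subdivision_Zinv[OF assms(1)] by auto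
    fix a b :: real assume *: "0 \<le> a \<and> a < b \<and> b \<le> 1 \<and> {a<..<b} \<inter> (fst ` set L \<union> snd ` set L) = {}"
    then have "(a + b) / 2 \<in> {0..1}" by auto
    then obtain I where I: "I \<in> set L" "(a + b) / 2 \<in> {fst I..snd I}"
      using tiles_cover[OF tL ne] by blast
    then have "fst I \<notin> {a<..<b}" "snd I \<notin> {a<..<b}" using * by blast+
    then have sub: "fst I \<le> a" "b \<le> snd I" using I(2) * by simp_all
    obtain i where i: "i < length L" "I = L ! i" using I by (auto simp: in_set_conv_nth)
    define J where "J = M ! i"
    have J: "J \<in> set M" "maps_affinely ?f I J"
      using i assms(3) af by (auto simp: J_def list_all2_conv_all_nth)
    let ?s = "(snd J - fst J) / (snd I - fst I)"
    have s: "?s \<in> slope_group k n"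
      using slope_group_divide subdivision_slope assms I J by blast
    have "?f x = ?f a + ?s * (x - a)" if "x \<in> {a..b}" for x
    proof -
      have "?f x = fst J + (x - fst I) * ?s" "?f a = fst J + (a - fst I) * ?s"
        using J(2) that sub * by (auto simp: maps_affinely_def)
      then show ?thesis by (simp only:) (simp only: algebra_simps)
    qed
    with s show "\<exists>s\<in>slope_group k n. \<forall>x\<in>{a..b}. ?f x = ?f a + s * (x - a)" by blast
  qed simp
  ultimately show ?thesis using pr by (simp add: thompson_stein_def N_def)
qed

lemma pl_elem_Bij: "subdivision L \<Longrightarrow> subdivision M \<Longrightarrow> length L = length M \<Longrightarrow> pl_elem L M \<in> Bij {0..1}"
  using pl_elem_carrier carrier_G_subset carrier_H by blast

text \<open>The factors share the middle subdivision \<open>L\<close>; they stand in reverse order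
  because the product is composition.\<close>

lemma pl_elem_mult:
  assumes "subdivision K" "subdivision L" "subdivision M" "length K = length L" "length L = length M"
  shows "pl_elem L M \<otimes>\<^bsub>H\<^esub> pl_elem K L = pl_elem K M"
proof -
  have t: "tiles K 0 1" "tiles L 0 1" "tiles M 0 1" using assms subdivision_tiles by auto
  have "list_all2 (maps_affinely (\<lambda>x. pl_elem L M (pl_elem K L x))) K M"
    using list_all2_maps_affinely_comp pl_elem_maps_affinely t assms(4,5) by metis
  then have "list_all2 (maps_affinely (compose {0..1} (pl_elem L M) (pl_elem K L))) K M"
    by (rule iffD1[OF list_all2_maps_affinely_cong[OF t(1)], rotated]) (simp add: compose_def)
  then have "compose {0..1} (pl_elem L M) (pl_elem K L) = pl_elem K M"
    by (intro pl_elem_unique t) (auto simp: compose_extensional)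
  then show ?thesis using assms pl_elem_Bij by (simp add: mult_H)
qed

lemma pl_elem_refl:
  assumes "subdivision L"
  shows "pl_elem L L = \<one>\<^bsub>H\<^esub>"
proof -
  have t: "tiles L 0 1" using assms subdivision_tiles by auto
  have "list_all2 (maps_affinely (\<lambda>x. x)) L L"
    using tiles_mem(2)[OF t] by (simp add: list.rel_refl_strong maps_affinely_id)
  then have "list_all2 (maps_affinely \<one>\<^bsub>H\<^esub>) L L"
    by (rule iffD1[OF list_all2_maps_affinely_cong[OF t], rotated]) (simp add: one_H)
  then show ?thesis by (intro pl_elem_unique[symmetric] t) (auto simp: one_H)
qed

text \<open>An affine map carries equal parts to equal parts (\<open>list_all2_subdivide\<close>),
  so the old map also fits the refined subdivisions and uniqueness applies.\<close>

lemma pl_elem_subdivide: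
  assumes "subdivision L" "subdivision M" "length L = length M" "i < length L" "j \<in> {1..k}"
  shows "pl_elem (subdivide L i (n j)) (subdivide M i (n j)) = pl_elem L M"
proof -
  have t: "tiles L 0 1" "tiles M 0 1" using assms subdivision_tiles by auto
  have "0 < n j" using arity_ge_2 assms(5) by force
  then show ?thesis using t assms(3-5)
    by (intro pl_elem_unique[symmetric] tiles_subdivide list_all2_subdivide[OF pl_elem_maps_affinely])
      (auto simp: pl_elem_def)
qed

lemma subdivision_leaf_intervals:
  assumes "ary_tree (n ` {1..k}) t"
  shows "subdivision (leaf_intervals t 0 1)"
proof -
  have "subdivision (subdivide L i q)" if "subdivision L" "i < length L" "q \<in> n ` {1..k}" for L i q
    using that step by blast
  then show ?thesis
    using tree_growth_induct[OF assms, of "\<lambda>L _. subdivision L" "[]" 0 1 "[]"] base by simp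
qed

section \<open>Positive elements and the infinite generators\<close>

definition R :: "nat \<Rightarrow> (real \<times> real) list" where
  "R m = leaf_intervals (right_string p m) 0 1"

lemma R_0 [simp]: "R 0 = [(0, 1)]"
  by (simp add: R_def)

lemma length_R: "length (R m) = m * (p - 1) + 1"
  by (simp add: R_def length_intervals leaves_right_string)

lemma R_Suc: "R (Suc m) = subdivide (R m) (m * (p - 1)) p"
  unfolding R_def using p_ge_2
  by (simp add: right_string_Suc_graft intervals_graft_caret leaves_right_string del: right_string.simps)

lemma subdivision_R: "subdivision (R m)"
  unfolding R_def using p_ge_2 by (intro subdivision_leaf_intervals ary_tree_right_string) auto

lemma subdivide_1: "subdivision L \<Longrightarrow> i < length L \<Longrightarrow> subdivision (subdivide L i p)"
  using step[of L i 1] by simp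

lemma subdivision_length_eq:
  assumes "subdivision L"
  obtains m where "length L = m * (p - 1) + 1"
proof -
  obtain m where "length L - 1 = (p - 1) * m" using subdivision_length[OF assms] by blast
  then have "length L = m * (p - 1) + 1" using subdivision_not_Nil[OF assms] by (cases L) auto
  then show thesis by (rule that)
qed

text \<open>The length determines the number of carets of the right string; for a subdivision the
  division is exact by \<open>subdivision_length\<close>.\<close>

definition pos :: "(real \<times> real) list \<Rightarrow> real \<Rightarrow> real" where
  "pos L = pl_elem (R ((length L - 1) div (p - 1))) L"

lemma pos_eq: "length L = m * (p - 1) + 1 \<Longrightarrow> pos L = pl_elem (R m) L"
  using p_ge_2 by (simp add: pos_def)

lemma pos_R [simp]: "pos (R m) = \<one>\<^bsub>H\<^esub>"
  by (simp add: pos_eq[OF length_R] pl_elem_refl subdivision_R)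

lemma pos_carrier: "subdivision L \<Longrightarrow> pos L \<in> carrier G"
  using subdivision_length_eq pos_eq pl_elem_carrier subdivision_R length_R by metis

lemma pos_carrier_H: "subdivision L \<Longrightarrow> pos L \<in> carrier H"
  using pos_carrier carrier_G_subset by blast

text \<open>\<open>gen m i j\<close> is the paper's \<open>(z\<^sub>j)\<^sub>i\<close> if \<open>i < m * (n 1 - 1)\<close> and \<open>(y\<^sub>j)\<^sub>m\<close> if \<open>i = m * (n 1 - 1)\<close>,
  where the last leaf of the right string is subdivided (so it is trivial for \<open>j = 1\<close>).\<close>

definition gen :: "nat \<Rightarrow> nat \<Rightarrow> nat \<Rightarrow> real \<Rightarrow> real" where
  "gen m i j = pos (subdivide (R m) i (n j))"

lemma gen_carrier:
  assumes "i \<le> m * (p - 1)" "j \<in> {1..k}"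
  shows "gen m i j \<in> carrier G" "gen m i j \<in> carrier H"
proof -
  have "subdivision (subdivide (R m) i (n j))"
    using assms step subdivision_R length_R by simp
  then show "gen m i j \<in> carrier G" "gen m i j \<in> carrier H"
    unfolding gen_def by (rule pos_carrier pos_carrier_H)+
qed

text \<open>A caret attached at leaf \<open>i\<close> of both \<open>R m\<close> and
  \<open>L\<close> leaves \<open>pos L\<close> unchanged. Precomposing with
  \<open>gen m i j\<close>, which carries a right string to the subdivided \<open>R m\<close>, makes
  the domain a right string again.\<close>

lemma pos_subdivide:
  assumes "subdivision L" "length L = m * (p - 1) + 1" "i < length L" "j \<in> {1..k}"
  shows "pos (subdivide L i (n j)) = pos L \<otimes>\<^bsub>H\<^esub> gen m i j"
proof -
  have s: "subdivision (subdivide L i (n j))" "subdivision (subdivide (R m) i (n j))"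
    using assms step subdivision_R length_R by auto
  obtain m' where m': "length (subdivide L i (n j)) = m' * (p - 1) + 1"
    using subdivision_length_eq s(1) by blast
  then have m'': "length (subdivide (R m) i (n j)) = m' * (p - 1) + 1"
    using assms by (simp add: length_subdivide length_R)
  have "pos L = pl_elem (subdivide (R m) i (n j)) (subdivide L i (n j))"
    using assms by (simp add: pos_eq pl_elem_subdivide subdivision_R length_R)
  moreover have "gen m i j = pl_elem (R m') (subdivide (R m) i (n j))"
    unfolding gen_def by (rule pos_eq[OF m''])
  moreover have "pos (subdivide L i (n j)) = pl_elem (R m') (subdivide L i (n j))"
    by (rule pos_eq[OF m'])
  ultimately show ?thesis
    using pl_elem_mult[OF subdivision_R s(2,1)] m' m'' by (simp add: length_R)
qed

lemma gen_last_1: "gen m (m * (p - 1)) 1 = \<one>\<^bsub>H\<^esub>"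
  unfolding gen_def R_Suc[symmetric] by (rule pos_R)

text \<open>Passing from \<open>R m\<close> to \<open>R (Suc m)\<close> attaches a caret of type
  \<open>n 1\<close> at the last leaf. This commutes with the caret at the earlier leaf
  \<open>i\<close> and multiplies by a trivial generator.\<close>

lemma gen_stable_Suc:
  assumes "i < m * (p - 1)" "j \<in> {1..k}"
  shows "gen (Suc m) i j = gen m i j"
proof -
  interpret group H by (rule group_BijGroup)
  let ?L = "subdivide (R m) i (n j)"
  have s: "subdivision ?L" using assms step subdivision_R length_R by simp
  then obtain m' where m': "length ?L = m' * (p - 1) + 1" using subdivision_length_eq by blast
  \<comment> \<open>The number of the last leaf of \<open>?L\<close>, so that
    \<open>gen_last_1\<close> applies to the caret attached there.\<close>
  have "m' * (p - 1) = m * (p - 1) + n j - 1"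
    using m' assms arity_ge_2[OF assms(2)] by (simp add: length_subdivide length_R)
  moreover have "subdivide ?L (m * (p - 1) + n j - 1) (n 1) = subdivide (R (Suc m)) i (n j)"
    unfolding R_Suc
    by (rule subdivide_commute) (use assms arity_ge_2[OF assms(2)] in \<open>auto simp: length_R\<close>)
  ultimately have "pos (subdivide (R (Suc m)) i (n j)) = pos ?L \<otimes>\<^bsub>H\<^esub> gen m' (m' * (p - 1)) 1"
    using pos_subdivide[OF s m', of "m' * (p - 1)" 1] m' by simp
  then show ?thesis
    unfolding gen_last_1 using pos_carrier_H[OF s] by (simp add: gen_def)
qed

lemma gen_stable:
  assumes "m \<le> m'" "i < m * (p - 1)" "j \<in> {1..k}"
  shows "gen m' i j = gen m i j"
  using assms(1)
proof (induction m' rule: dec_induct)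
  case (step m')
  have "m * (p - 1) \<le> m' * (p - 1)" using step.hyps by simp
  then have "i < m' * (p - 1)" using assms(2) by linarith
  then show ?case using step gen_stable_Suc assms(3) by simp
qed simp

text \<open>The generator \<open>(z\<^sub>1)\<^sub>0\<close>.\<close>

definition shift :: "real \<Rightarrow> real" where "shift = gen 1 0 1"

lemma shift_carrier: "shift \<in> carrier G" "shift \<in> carrier H"
  unfolding shift_def using gen_carrier[of 0 1 1] by simp_all

lemma gen_0_1: "1 \<le> m \<Longrightarrow> gen m 0 1 = shift"
  unfolding shift_def using gen_stable[of 1 m 0 1] p_ge_2 by simp

text \<open>Subdivide leaf \<open>0\<close> into \<open>n 1\<close> and leaf \<open>i\<close> into \<open>n j\<close> parts, in both orders.\<close>

lemma gen_shift:
  assumes "1 \<le> i" "i \<le> m * (p - 1)" "j \<in> {1..k}"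
  shows "gen m i j \<otimes>\<^bsub>H\<^esub> shift = shift \<otimes>\<^bsub>H\<^esub> gen (Suc m) (i + (p - 1)) j"
proof -
  have m: "1 \<le> m" using assms by (cases m) auto
  have nj: "2 \<le> n j" using arity_ge_2 assms(3) .
  let ?L = "subdivide (R m) i (n j)" and ?M = "subdivide (R m) 0 p"
  have sL: "subdivision ?L" using assms step subdivision_R length_R by simp
  then obtain m' where m': "length ?L = m' * (p - 1) + 1" using subdivision_length_eq by blast
  have "length ?L > 1" using assms nj by (simp add: length_subdivide length_R)
  then have "m' \<ge> 1" using m' by (cases m') auto
  have sM: "subdivision ?M" using subdivide_1 subdivision_R length_R by simp
  have lM: "length ?M = Suc m * (p - 1) + 1"
    using p_ge_2 by (simp add: length_subdivide length_R)
  have "subdivide ?M (i + (p - 1)) (n j) = subdivide ?L 0 p"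
    using subdivide_commute[of 0 i "R m" p "n j"] assms p_ge_2 by (simp add: length_R)
  moreover have "pos (subdivide ?L 0 p) = gen m i j \<otimes>\<^bsub>H\<^esub> shift"
    using pos_subdivide[OF sL m', of 0 1] m' gen_0_1[OF \<open>m' \<ge> 1\<close>] by (simp add: gen_def)
  moreover have "pos (subdivide ?M (i + (p - 1)) (n j)) = pos ?M \<otimes>\<^bsub>H\<^esub> gen (Suc m) (i + (p - 1)) j"
    using pos_subdivide[OF sM lM, of "i + (p - 1)" j] assms lM by simp
  moreover have "pos ?M = shift" using gen_0_1[OF m] by (simp add: gen_def)
  ultimately show ?thesis by simp
qed

section \<open>Diagrams and the standard generators\<close>

text \<open>Membership in the carrier is automatic by \<open>pl_elem_carrier\<close>, and the
  affinity conditions determine the map by \<open>pl_elem_unique\<close>.\<close>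

lemma represents_iff:
  "represents k n S T x \<longleftrightarrow>
     ary_tree (n ` {1..k}) S \<and> ary_tree (n ` {1..k}) T \<and> leaves S = leaves T \<and>
     x = pl_elem (leaf_intervals S 0 1) (leaf_intervals T 0 1)"
  (is "_ \<longleftrightarrow> ?A \<and> ?B \<and> ?C \<and> _")
proof (cases "?A \<and> ?B \<and> ?C")
  case True
  then have s: "subdivision (leaf_intervals S 0 1)" "subdivision (leaf_intervals T 0 1)"
    using subdivision_leaf_intervals by auto
  have l: "length (leaf_intervals S 0 1) = length (leaf_intervals T 0 1)"
    using True by (simp add: length_intervals)
  have "(\<forall>i < leaves S. maps_affinely x (leaf_intervals S 0 1 ! i) (leaf_intervals T 0 1 ! i))
      \<longleftrightarrow> list_all2 (maps_affinely x) (leaf_intervals S 0 1) (leaf_intervals T 0 1)"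
    using l by (simp add: list_all2_conv_all_nth length_intervals)
  then have "represents k n S T x \<longleftrightarrow>
      x \<in> carrier G \<and> list_all2 (maps_affinely x) (leaf_intervals S 0 1) (leaf_intervals T 0 1)"
    using True by (simp add: represents_def tree_pair_diagram_def)
  also have "\<dots> \<longleftrightarrow> x = pl_elem (leaf_intervals S 0 1) (leaf_intervals T 0 1)" (is "?P \<longleftrightarrow> ?Q")
  proof
    assume ?P
    moreover from this have "x \<in> extensional {0..1}"
      using carrier_G_subset carrier_H Bij_imp_extensional by blast
    ultimately show ?Q
      using s subdivision_tiles by (intro pl_elem_unique) auto
  next
    assume ?Q
    then show ?P
      using pl_elem_carrier[OF s l] pl_elem_maps_affinely[OF _ _ l] s subdivision_tiles by auto
  qed
  finally show ?thesis using True by simp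
qed (auto simp: represents_def tree_pair_diagram_def)

text \<open>Justifies the definite description: the number of leaves of \<open>T\<close> fixes
  \<open>m\<close>, and then the map is determined.\<close>

lemma positive_element_eq:
  assumes "ary_tree (n ` {1..k}) T"
  shows "positive_element k n T = pos (leaf_intervals T 0 1)"
proof -
  obtain m where m: "length (leaf_intervals T 0 1) = m * (p - 1) + 1"
    using subdivision_length_eq subdivision_leaf_intervals assms by blast
  have "ary_tree (n ` {1..k}) (right_string p m')" for m'
    using p_ge_2 by (intro ary_tree_right_string) auto
  then have *: "represents k n (right_string p m') T x \<longleftrightarrow> m' = m \<and> x = pos (leaf_intervals T 0 1)" for m' x
    using assms m p_ge_2 pos_eq[OF m]
    by (auto simp: represents_iff leaves_right_string length_intervals R_def)
  show ?thesis unfolding positive_element_def * by simp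
qed

abbreviation X where "X \<equiv> standard_generators k n"

lemma y_mem_X:
  assumes "j \<in> {2..k}" "i \<le> n j - 1"
  shows "gen i (i * (p - 1)) j \<in> X"
proof -
  let ?T = "y_range n j i"
  have T: "?T = graft (right_string p i) (i * (p - 1)) (single_caret (n j))"
    by (simp add: y_range_def leaves_right_string)
  have "ary_tree (n ` {1..k}) ?T"
    unfolding T using p_ge_2 assms
    by (intro ary_tree_graft ary_tree_right_string ary_tree_single_caret) auto
  moreover have "leaf_intervals ?T 0 1 = subdivide (R i) (i * (p - 1)) (n j)"
    unfolding T R_def by (simp add: intervals_graft_caret leaves_right_string)
  ultimately have "gen i (i * (p - 1)) j = positive_element k n ?T"
    by (simp add: positive_element_eq gen_def)
  then show ?thesis using assms unfolding standard_generators_def by auto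
qed

lemma z_mem_X:
  assumes "j \<in> {1..k}" "i \<le> n j - 1" "i < m * (p - 1)"
  shows "gen m i j \<in> X"
proof -
  let ?T = "z_range n j i"
  \<comment> \<open>The number of carets in the definition of \<open>(z\<^sub>j)\<^sub>i\<close>,
    the least one for which leaf \<open>i\<close> is not the last; \<open>gen_stable\<close> passes
    from \<open>m0\<close> to \<open>m\<close>.\<close>
  define m0 where "m0 = i div (p - 1) + 1"
  have i: "i < m0 * (p - 1)"
    unfolding m0_def distrib_right using dividend_less_div_times[of "p - 1" i] p_ge_2 by linarith
  have T: "?T = graft (right_string p m0) i (single_caret (n j))"
    by (simp add: z_range_def m0_def)
  have "ary_tree (n ` {1..k}) ?T"
    unfolding T using p_ge_2 assms
    by (intro ary_tree_graft ary_tree_right_string ary_tree_single_caret) auto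
  moreover have "leaf_intervals ?T 0 1 = subdivide (R m0) i (n j)"
    unfolding T R_def using i by (simp add: intervals_graft_caret leaves_right_string)
  ultimately have "gen m0 i j = positive_element k n ?T"
    by (simp add: positive_element_eq gen_def)
  moreover have "m0 \<le> m"
    using assms(3) p_ge_2 unfolding m0_def by (simp add: less_mult_imp_div_less Suc_leI)
  then have "gen m i j = gen m0 i j" using gen_stable i assms by blast
  ultimately show ?thesis using assms unfolding standard_generators_def by auto
qed

subsection \<open>Word length of positive elements\<close>

interpretation H: group H
  by (rule group_BijGroup)

abbreviation word :: "(real \<Rightarrow> real) list \<Rightarrow> real \<Rightarrow> real" where
  "word ws \<equiv> foldr (mult H) ws \<one>\<^bsub>H\<^esub>"

lemma X_subset: "X \<subseteq> carrier G"
proof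
  fix x assume "x \<in> X"
  then consider j i where "j \<in> {2..k}" "x = positive_element k n (y_range n j i)"
    | j i where "j \<in> {1..k}" "x = positive_element k n (z_range n j i)"
    unfolding standard_generators_def by blast
  then obtain T where "ary_tree (n ` {1..k}) T" "x = positive_element k n T"
  proof cases
    case 1
    show thesis
      by (rule that[OF _ 1(2)])
        (use 1(1) p_ge_2 in \<open>auto simp: y_range_def Let_def intro!: ary_tree_graft ary_tree_right_string ary_tree_single_caret\<close>)
  next
    case 2
    show thesis
      by (rule that[OF _ 2(2)])
        (use 2(1) p_ge_2 in \<open>auto simp: z_range_def intro!: ary_tree_graft ary_tree_right_string ary_tree_single_caret
          simp del: right_string.simps\<close>)
  qed
  then show "x \<in> carrier G" using positive_element_eq pos_carrier subdivision_leaf_intervals by simp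
qed

lemma shift_mem_X: "shift \<in> X"
  unfolding shift_def using z_mem_X[of 1 0 1] p_ge_2 by simp

text \<open>Swapping the two subdivisions of \<open>shift\<close> shows that its inverse in
  \<open>H\<close> stays in the carrier of \<open>G\<close>. The words built below contain no other
  inverses.\<close>

lemma inv_shift: "m_inv G shift = inv\<^bsub>H\<^esub> shift"
proof -
  let ?L = "subdivide (R 1) 0 (n 1)"
  have s: "subdivision ?L" using step[OF subdivision_R] length_R by simp
  have l: "length ?L = 2 * (p - 1) + 1" using p_ge_2 by (simp add: length_subdivide length_R)
  have "shift = pl_elem (R 2) ?L" unfolding shift_def gen_def by (rule pos_eq[OF l])
  then have "pl_elem ?L (R 2) \<otimes>\<^bsub>H\<^esub> shift = \<one>\<^bsub>H\<^esub>"
    using pl_elem_mult[OF subdivision_R s subdivision_R] l pl_elem_refl subdivision_R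
    by (simp add: length_R)
  moreover have c: "pl_elem ?L (R 2) \<in> carrier G"
    using pl_elem_carrier[OF s subdivision_R] l by (simp add: length_R)
  ultimately have "inv\<^bsub>H\<^esub> shift = pl_elem ?L (R 2)"
    using carrier_G_subset shift_carrier by (intro H.inv_equality) auto
  then have c': "inv\<^bsub>H\<^esub> shift \<in> carrier G" using c by simp
  show "m_inv G shift = inv\<^bsub>H\<^esub> shift"
    unfolding m_inv_def[of G]
  proof (rule the_equality)
    show "inv\<^bsub>H\<^esub> shift \<in> carrier G \<and> shift \<otimes>\<^bsub>G\<^esub> inv\<^bsub>H\<^esub> shift = \<one>\<^bsub>G\<^esub> \<and> inv\<^bsub>H\<^esub> shift \<otimes>\<^bsub>G\<^esub> shift = \<one>\<^bsub>G\<^esub>"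
      using c' shift_carrier by simp
    fix y assume "y \<in> carrier G \<and> shift \<otimes>\<^bsub>G\<^esub> y = \<one>\<^bsub>G\<^esub> \<and> y \<otimes>\<^bsub>G\<^esub> shift = \<one>\<^bsub>G\<^esub>"
    then show "y = inv\<^bsub>H\<^esub> shift"
      using H.inv_equality[of y shift] shift_carrier carrier_G_subset by auto
  qed
qed

abbreviation Y where "Y \<equiv> insert (m_inv G shift) X"

text \<open>By \<open>gen_shift\<close>, moving \<open>shift\<close> past a generator lowers the
  index by \<open>p - 1\<close>, as long as the result is at least 1. The exponent counts these
  moves until the index is at most \<open>p - 1\<close>; there the generator is trivial or belongs
  to \<open>X\<close>.\<close>

lemma gen_conj_X:
  assumes "i \<le> m * (p - 1)" "j \<in> {1..k}"
  shows "\<exists>as. set as \<subseteq> X \<and> length as \<le> 1 \<and>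
    shift [^]\<^bsub>H\<^esub> ((i - 1) div (p - 1)) \<otimes>\<^bsub>H\<^esub> gen m i j
      = word as \<otimes>\<^bsub>H\<^esub> shift [^]\<^bsub>H\<^esub> ((i - 1) div (p - 1))"
  using assms(1)
proof (induction i arbitrary: m rule: less_induct)
  case (less i)
  have p_pos: "0 < p - 1" using p_ge_2 by simp
  show ?case
  proof (cases "i \<le> p - 1")
    case True
    then have q: "(i - 1) div (p - 1) = 0" using p_pos by simp
    have in_H: "gen m i j \<in> carrier H" using gen_carrier(2) less.prems assms(2) .
    \<comment> \<open>Away from the last leaf this is some \<open>(z\<^sub>j)\<^sub>i\<close>, with
      index in range as \<open>p \<le> n j\<close>. At the last leaf \<open>m \<le> 1\<close>, so it
      is trivial for \<open>j = 1\<close> and otherwise \<open>(y\<^sub>j)\<^sub>0\<close> or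
      \<open>(y\<^sub>j)\<^sub>1\<close>.\<close>
    have "gen m i j = \<one>\<^bsub>H\<^esub> \<or> gen m i j \<in> X"
    proof (cases "i < m * (p - 1)")
      case False
      then have i: "i = m * (p - 1)" using less.prems by simp
      have "m \<le> 1" using True p_pos unfolding i by (cases m) auto
      then have "m \<le> n j - 1" using arity_ge_2[OF assms(2)] by simp
      then show ?thesis
        using gen_last_1[of m] y_mem_X[of j m] assms(2) unfolding i by (cases "j = 1") auto
    qed (use True p_le_arity[OF assms(2)] assms(2) z_mem_X in auto)
    then show ?thesis
    proof
      assume "gen m i j = \<one>\<^bsub>H\<^esub>"
      then show ?thesis unfolding q by (intro exI[of _ "[]"]) simp
    next
      assume "gen m i j \<in> X"
      then show ?thesis unfolding q using in_H by (intro exI[of _ "[gen m i j]"]) simp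
    qed
  next
    case False
    have "m \<noteq> 0" using False less.prems by (cases m) auto
    then obtain m' where m: "m = Suc m'" by (cases m) auto
    define i' where "i' = i - (p - 1)"
    define q where "q = (i' - 1) div (p - 1)"
    have i': "i' < i" "1 \<le> i'" "i' \<le> m' * (p - 1)" "i = i' + (p - 1)"
      using False p_pos less.prems unfolding i'_def m by auto
    have "i - 1 = (i' - 1) + (p - 1)" using i' by simp
    then have q: "(i - 1) div (p - 1) = Suc q"
      unfolding q_def using p_pos div_add_self2[of "p - 1" "i' - 1"] by (metis Suc_eq_plus1 less_not_refl)
    obtain as where as: "set as \<subseteq> X" "length as \<le> 1"
      "shift [^]\<^bsub>H\<^esub> q \<otimes>\<^bsub>H\<^esub> gen m' i' j = word as \<otimes>\<^bsub>H\<^esub> shift [^]\<^bsub>H\<^esub> q"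
      using less.IH[OF i'(1,3)] unfolding q_def by blast
    have c: "gen m' i' j \<in> carrier H" "gen m i j \<in> carrier H" "word as \<in> carrier H"
      using gen_carrier(2) i' less.prems assms(2) as(1) X_subset carrier_G_subset
      by (auto intro!: H.foldr_mult_closed)
    have "shift [^]\<^bsub>H\<^esub> Suc q \<otimes>\<^bsub>H\<^esub> gen m i j
        = shift [^]\<^bsub>H\<^esub> q \<otimes>\<^bsub>H\<^esub> (shift \<otimes>\<^bsub>H\<^esub> gen m i j)"
      using c shift_carrier by (simp add: H.m_assoc)
    also have "\<dots> = shift [^]\<^bsub>H\<^esub> q \<otimes>\<^bsub>H\<^esub> (gen m' i' j \<otimes>\<^bsub>H\<^esub> shift)"
      using gen_shift[OF i'(2,3) assms(2)] unfolding i'(4) m by simp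
    also have "\<dots> = (shift [^]\<^bsub>H\<^esub> q \<otimes>\<^bsub>H\<^esub> gen m' i' j) \<otimes>\<^bsub>H\<^esub> shift"
      using c shift_carrier by (simp add: H.m_assoc)
    also have "\<dots> = word as \<otimes>\<^bsub>H\<^esub> shift [^]\<^bsub>H\<^esub> Suc q"
      unfolding as(3) using c shift_carrier by (simp add: H.m_assoc)
    finally show ?thesis unfolding q using as(1,2) by blast
  qed
qed

lemma Y_subset: "Y \<subseteq> carrier H"
  using X_subset carrier_G_subset shift_carrier(2) by (auto simp: inv_shift)

text \<open>The power of \<^const>\<open>shift\<close> is kept apart from the word, so that consecutive conjugating powers
  cancel when the word is extended.\<close>

definition reachable :: "(real \<times> real) list \<Rightarrow> nat \<Rightarrow> bool" where
  "reachable L i \<longleftrightarrow> subdivision L \<and> (\<exists>ws q. set ws \<subseteq> Y \<and> q \<le> (i - 1) div (p - 1) \<and>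
     length ws \<le> length L + q \<and> pos L = word ws \<otimes>\<^bsub>H\<^esub> shift [^]\<^bsub>H\<^esub> q)"

lemma reachable_base: "reachable [(0, 1)] 0"
proof -
  have "pos [(0, 1)] = \<one>\<^bsub>H\<^esub>" using pos_R[of 0] by simp
  then show ?thesis
    unfolding reachable_def using base by (intro conjI exI[of _ "[]"] exI[of _ 0]) auto
qed

lemma reachable_mono:
  assumes "reachable L i" "i \<le> i'"
  shows "reachable L i'"
proof -
  have "(i - 1) div (p - 1) \<le> (i' - 1) div (p - 1)" using assms(2) by (intro div_le_mono) simp
  then show ?thesis using assms(1) order_trans unfolding reachable_def by blast
qed

text \<open>With \<open>q'\<close> the exponent for leaf \<open>i\<close>, write the stored power as
  \<open>q' - q\<close> inverse shifts times the power \<open>q'\<close>. Moving the latter past the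
  new generator leaves at most one letter of \<open>X\<close> and stores \<open>q'\<close> in place
  of \<open>q\<close>.\<close>

lemma reachable_step:
  assumes "reachable L i" "i < length L" "j \<in> {1..k}"
  shows "reachable (subdivide L i (n j)) i"
proof -
  obtain ws q where L: "subdivision L" and ws: "set ws \<subseteq> Y" "q \<le> (i - 1) div (p - 1)"
    "length ws \<le> length L + q" "pos L = word ws \<otimes>\<^bsub>H\<^esub> shift [^]\<^bsub>H\<^esub> q"
    using assms(1) unfolding reachable_def by blast
  obtain m where m: "length L = m * (p - 1) + 1" using subdivision_length_eq L by blast
  define q' where "q' = (i - 1) div (p - 1)"
  obtain as where as: "set as \<subseteq> X" "length as \<le> 1"
    "shift [^]\<^bsub>H\<^esub> q' \<otimes>\<^bsub>H\<^esub> gen m i j = word as \<otimes>\<^bsub>H\<^esub> shift [^]\<^bsub>H\<^esub> q'"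
    using gen_conj_X[of i m j] assms(2,3) m unfolding q'_def by auto
  define ws' where "ws' = ws @ replicate (q' - q) (m_inv G shift) @ as"
  have in_H: "set ws \<subseteq> carrier H" "set as \<subseteq> carrier H" "gen m i j \<in> carrier H"
    using ws(1) as(1) Y_subset gen_carrier(2)[of i m j] assms m by auto
  then have word_H: "word ws \<in> carrier H" "word as \<in> carrier H"
    using H.foldr_mult_closed by auto
  have "shift [^]\<^bsub>H\<^esub> q' = shift [^]\<^bsub>H\<^esub> (q' - q) \<otimes>\<^bsub>H\<^esub> shift [^]\<^bsub>H\<^esub> q"
    using ws(2) shift_carrier by (simp add: H.nat_pow_mult q'_def)
  then have "shift [^]\<^bsub>H\<^esub> q = inv\<^bsub>H\<^esub> (shift [^]\<^bsub>H\<^esub> (q' - q)) \<otimes>\<^bsub>H\<^esub> shift [^]\<^bsub>H\<^esub> q'"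
    using shift_carrier by (simp add: H.inv_solve_left)
  then have shift_q: "shift [^]\<^bsub>H\<^esub> q
      = word (replicate (q' - q) (m_inv G shift)) \<otimes>\<^bsub>H\<^esub> shift [^]\<^bsub>H\<^esub> q'"
    using shift_carrier by (simp add: inv_shift H.funpow_mult_one H.nat_pow_inv)
  have word_inv: "word (replicate (q' - q) (m_inv G shift)) \<in> carrier H"
    using shift_carrier by (intro H.foldr_mult_closed) (auto simp: inv_shift)
  have "set (replicate (q' - q) (m_inv G shift)) \<subseteq> carrier H"
    using shift_carrier by (auto simp: inv_shift)
  then have word': "word ws' = word ws \<otimes>\<^bsub>H\<^esub> word (replicate (q' - q) (m_inv G shift)) \<otimes>\<^bsub>H\<^esub> word as"
    unfolding ws'_def using in_H word_H word_inv
    by (simp add: H.foldr_mult_append H.m_assoc del: foldr_append foldr_replicate)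
  have "pos (subdivide L i (n j)) = word ws \<otimes>\<^bsub>H\<^esub> shift [^]\<^bsub>H\<^esub> q \<otimes>\<^bsub>H\<^esub> gen m i j"
    using pos_subdivide[OF L m assms(2,3)] ws(4) by simp
  also have "\<dots> = word ws \<otimes>\<^bsub>H\<^esub> word (replicate (q' - q) (m_inv G shift))
      \<otimes>\<^bsub>H\<^esub> (shift [^]\<^bsub>H\<^esub> q' \<otimes>\<^bsub>H\<^esub> gen m i j)"
    unfolding shift_q using word_H word_inv in_H shift_carrier by (simp add: H.m_assoc)
  also have "\<dots> = word ws' \<otimes>\<^bsub>H\<^esub> shift [^]\<^bsub>H\<^esub> q'"
    unfolding as(3) word' using word_H word_inv shift_carrier by (simp add: H.m_assoc)
  finally have "pos (subdivide L i (n j)) = word ws' \<otimes>\<^bsub>H\<^esub> shift [^]\<^bsub>H\<^esub> q'" .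
  moreover have "set ws' \<subseteq> Y"
    unfolding ws'_def using ws(1) as(1) shift_mem_X by auto
  \<comment> \<open>The inverse shifts are paid for by the growth from \<open>q\<close> to
    \<open>q'\<close>, the letter of \<open>as\<close> by the growth of the list.\<close>
  moreover have "length ws' \<le> length (subdivide L i (n j)) + q'"
    using ws(2,3) as(2) assms(2) arity_ge_2[OF assms(3)]
    by (simp add: ws'_def q'_def length_subdivide)
  moreover have "subdivision (subdivide L i (n j))" using step L assms(2,3) .
  ultimately show ?thesis unfolding reachable_def q'_def by blast
qed

lemma word_length_pos_le:
  assumes "ary_tree (n ` {1..k}) T"
  shows "word_length G X (pos (leaf_intervals T 0 1)) \<le> enat (3 * leaves T)"
proof -
  let ?L = "leaf_intervals T 0 1"
  have "reachable (subdivide L i q) i" if "reachable L i" "i < length L" "q \<in> n ` {1..k}" for L i q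
    using that reachable_step by blast
  then have "reachable ?L (leaves T)"
    using tree_growth_induct[OF assms, of reachable "[]" 0 1 "[]"] reachable_base reachable_mono
    by simp
  then obtain ws q where ws: "set ws \<subseteq> Y" "q \<le> (leaves T - 1) div (p - 1)"
    "length ws \<le> leaves T + q" "pos ?L = word ws \<otimes>\<^bsub>H\<^esub> shift [^]\<^bsub>H\<^esub> q"
    unfolding reachable_def by (auto simp: length_intervals)
  \<comment> \<open>The stored power is now written out. The length is at most
    \<open>leaves T + 2 * q\<close> with \<open>q \<le> leaves T\<close>, which gives the factor
    3.\<close>
  define us where "us = ws @ replicate q shift"
  have "set ws \<subseteq> carrier H"
    using ws(1) Y_subset by blast
  then have "word us = pos ?L"
    unfolding us_def ws(4) using shift_carrier
    by (subst H.foldr_mult_append) (auto simp: H.funpow_mult_one)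
  moreover have "set us \<subseteq> X \<union> m_inv G ` X" using ws(1) shift_mem_X by (auto simp: us_def)
  ultimately have "word_length G X (pos ?L) \<le> enat (length us)"
    unfolding word_length_def by (intro INF_lower) simp
  moreover have "q \<le> leaves T" using ws(2) div_le_dividend[of "leaves T - 1" "p - 1"] by linarith
  then have "length us \<le> 3 * leaves T" using ws(3) by (simp add: us_def)
  ultimately show ?thesis by (meson enat_ord_simps(1) order_trans)
qed

subsection \<open>Number of leaves\<close>

lemma R_last: "\<exists>A. R m = A @ [(1 - 1 / real p ^ m, 1)]"
proof (induction m)
  case (Suc m)
  then obtain A where A: "R m = A @ [(1 - 1 / real p ^ m, 1)]" by blast
  let ?I = "(1 - 1 / real p ^ m, 1 :: real)"
  have lt: "fst ?I < snd ?I" using p_ge_2 by simp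
  have "length A = m * (p - 1)" using arg_cong[OF A, of length] length_R[of m] by simp
  then have R: "R (Suc m) = A @ pieces p ?I"
    using subdivide_append[of A ?I "[]" p] by (simp add: R_Suc A)
  have ne: "pieces p ?I \<noteq> []" using p_ge_2 by (metis length_pieces list.size(3) not_numeral_le_zero)
  then obtain B J where J: "pieces p ?I = B @ [J]" by (metis rev_exhaust)
  have "snd J - fst J = 1 / real p ^ m / real p"
    using pieces_interval_length[of J p ?I] J by simp
  moreover have "snd J = 1"
    using tiles_pieces[OF lt, of p] p_ge_2 unfolding J by (auto simp: tiles_append)
  ultimately have "J = (1 - 1 / real p ^ Suc m, 1)" by (simp add: prod_eq_iff mult.commute)
  then show ?case using R J by simp
qed simp

lemma R_Suc_append:
  assumes "R m = A @ [(1 - 1 / real p ^ m, 1)]"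
  shows "R (Suc m) = A @ pieces p (1 - 1 / real p ^ m, 1)"
proof -
  have "length A = m * (p - 1)" using arg_cong[OF assms, of length] length_R[of m] by simp
  then show ?thesis using subdivide_append[of A _ "[]" p] by (simp add: R_Suc assms)
qed

text \<open>The interval of affinity covers the last two carets of the right string. So the images
  of the last \<open>p\<close> leaves have equal width, while the leaf before them is
  \<open>p\<close> times as wide and so is its image. Then \<open>remove_last_caret\<close> strips
  both trees.\<close>

lemma positive_diagram_shrink:
  assumes rep: "represents k n (right_string p (Suc (Suc m))) T w"
    and aff: "affine_on w (1 - 1 / real p ^ m) 1"
  shows "\<exists>T'. represents k n (right_string p (Suc m)) T' w"
proof -
  define c where "c = 1 - 1 / real p ^ Suc m"
  let ?L = "leaf_intervals T 0 1"
  have T: "ary_tree (n ` {1..k}) T" "w = pl_elem (R (Suc (Suc m))) ?L"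
    "length ?L = length (R (Suc (Suc m)))"
    using rep by (auto simp: represents_iff R_def length_intervals simp del: right_string.simps)
  have tL: "tiles ?L 0 1" and tR: "\<And>m. tiles (R m) 0 1"
    using subdivision_tiles subdivision_leaf_intervals T(1) subdivision_R by auto
  have w: "list_all2 (maps_affinely w) (R (Suc (Suc m))) ?L"
    unfolding T(2) by (rule pl_elem_maps_affinely) (use tL tR T(3) in auto)
  have ne: "R (Suc (Suc m)) \<noteq> []" using subdivision_not_Nil subdivision_R by blast
  have w1: "w 1 = 1" and mono: "strict_mono_on {0..1} w"
    using pl_properties[OF w tR tL ne] by auto
  obtain A where A: "R m = A @ [(1 - 1 / real p ^ m, 1)]" using R_last by blast
  obtain B where B: "R (Suc m) = B @ [(c, 1)]" using R_last unfolding c_def by blast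
  have R2: "R (Suc (Suc m)) = B @ pieces p (c, 1)" using R_Suc_append B unfolding c_def by blast
  have p_real: "1 < real p" using p_ge_2 by simp
  have pow: "real p ^ m \<ge> 1" using p_real by simp
  have c: "1 - 1 / real p ^ m < c" "c < 1" "0 \<le> 1 - 1 / real p ^ m"
    unfolding c_def using p_real pow by (simp_all add: field_simps)
  obtain s t where st: "\<And>x. x \<in> {1 - 1 / real p ^ m..1} \<Longrightarrow> w x = t + s * x"
    using aff unfolding affine_on_def by blast
  have wc: "w c = t + s * c" "w 1 = t + s * 1" using st c by auto
  have "w c < w 1" using strict_mono_onD[OF mono, of c 1] c by simp
  then have "0 < s * (1 - c)" using wc by (simp add: algebra_simps)
  then have s: "0 < s" using c by (simp add: zero_less_mult_iff)
  have "affine_on w c 1" using affine_on_subset aff c by fastforce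
  then have mc: "maps_affinely w (c, 1) (w c, 1)" using affine_on_maps_affinely c w1 by force
  obtain D E where DE: "?L = D @ E" "list_all2 (maps_affinely w) B D"
    "list_all2 (maps_affinely w) (pieces p (c, 1)) E"
    using w unfolding R2 list_all2_append1 by blast
  \<comment> \<open>Affinity on the last caret forces its targets to be \<open>p\<close> equal parts
    of the image.\<close>
  have "list_all2 (maps_affinely w) (pieces p (c, 1)) (pieces p (w c, 1))"
    using list_all2_pieces mc c p_ge_2 by simp
  then have E: "E = pieces p (w c, 1)"
    using list_all2_target_unique[OF DE(3)] tiles_pieces[of "(c, 1)" p] c p_ge_2 by simp
  have "(1 - w c) / real p < snd (last D) - fst (last D)" if "D \<noteq> []"
  proof -
    have "B \<noteq> []" using that DE(2) by auto
    have "pieces p (1 - 1 / real p ^ m, 1) \<noteq> []"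
      using p_ge_2 by (metis length_pieces list.size(3) not_numeral_le_zero)
    then obtain P J where P: "pieces p (1 - 1 / real p ^ m, 1) = P @ [J]" by (metis rev_exhaust)
    have "B @ [(c, 1)] = A @ P @ [J]" using R_Suc_append[OF A] B P by simp
    \<comment> \<open>So the leaf before the block is a sibling of \<open>(c, 1)\<close> and has
      width \<open>1 - c\<close>.\<close>
    then have BP: "B = A @ P" by simp
    have "length P = p - 1" using arg_cong[OF P, of length] by simp
    then have "P \<noteq> []" using p_ge_2 by auto
    then have last: "last B \<in> set (pieces p (1 - 1 / real p ^ m, 1))" using BP P by simp
    define I where "I = last B"
    have len: "snd I - fst I = 1 - c"
      using pieces_interval_length[OF last] unfolding I_def c_def by simp
    have "tiles (pieces p (1 - 1 / real p ^ m, 1)) (1 - 1 / real p ^ m) 1"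
      using tiles_pieces[of "(1 - 1 / real p ^ m, 1)" p] p_ge_2 by simp
    from tiles_mem[OF this last] have I: "fst I \<in> {1 - 1 / real p ^ m..1}"
      "snd I \<in> {1 - 1 / real p ^ m..1}" "fst I < snd I" unfolding I_def by auto
    have "maps_affinely w I (last D)"
      using DE(2) that \<open>B \<noteq> []\<close> list_all2_lengthD[OF DE(2)] unfolding I_def
      by (simp add: last_conv_nth list_all2_conv_all_nth)
    from maps_affinely_endpoints[OF this I(3)] have "snd (last D) - fst (last D) = s * (snd I - fst I)"
      using st[OF I(1)] st[OF I(2)] by (simp add: algebra_simps)
    also have "\<dots> = 1 - w c" unfolding len using wc w1 by (simp add: algebra_simps)
    finally have "snd (last D) - fst (last D) = 1 - w c" .
    moreover have "0 < 1 - w c" using \<open>w c < w 1\<close> w1 by simp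
    then have "(1 - w c) / real p < (1 - w c) / 1"
      using p_real by (intro divide_strict_left_mono) auto
    ultimately show ?thesis by simp
  qed
  moreover have "\<forall>q\<in>n ` {1..k}. p \<le> q" using p_le_arity by blast
  ultimately obtain T' where T': "ary_tree (n ` {1..k}) T'" "leaf_intervals T' 0 1 = D @ [(w c, 1)]"
    using remove_last_caret[of "n ` {1..k}" p T 0 1 "w c" D] p_ge_2 T(1) DE(1) E \<open>w c < w 1\<close> w1 by auto
  have wT': "list_all2 (maps_affinely w) (R (Suc m)) (leaf_intervals T' 0 1)"
    unfolding B T'(2) using DE(2) mc by (simp add: list_all2_appendI)
  have "w \<in> extensional {0..1}" unfolding T(2) pl_elem_def by simp
  moreover have "tiles (leaf_intervals T' 0 1) 0 1"
    using subdivision_tiles subdivision_leaf_intervals T'(1) by blast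
  ultimately have "w = pl_elem (R (Suc m)) (leaf_intervals T' 0 1)"
    using wT' by (intro pl_elem_unique tR)
  moreover have "length (R (Suc m)) = length (leaf_intervals T' 0 1)"
    using wT' by (rule list_all2_lengthD)
  ultimately have "represents k n (right_string p (Suc m)) T' w"
    using T'(1) ary_tree_right_string[of p "n ` {1..k}" "Suc m"] p_ge_2
    by (auto simp: represents_iff R_def length_intervals simp del: right_string.simps)
  then show ?thesis by blast
qed

text \<open>A breakpoint of \<open>w\<close> near 1 has denominator close to
  \<open>p ^ Suc (Suc m)\<close>, yet it must be an endpoint in every domain tree, which limits its
  denominator through \<open>N\<close>.\<close>

lemma right_string_depth_le:
  assumes rep: "represents k n (right_string p (Suc (Suc m))) T w"
    and not_affine: "\<not> affine_on w (1 - 1 / real p ^ m) 1"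
    and rep': "represents k n S' T' w"
  shows "Suc (Suc m) \<le> p\<^sup>2 + leaves S' * N"
proof -
  let ?L = "leaf_intervals T 0 1" and ?S = "leaf_intervals S' 0 1" and ?T = "leaf_intervals T' 0 1"
  define c where "c = 1 - 1 / real p ^ Suc m"
  define c0 where "c0 = 1 - 1 / real p ^ m"
  have T: "ary_tree (n ` {1..k}) T" "w = pl_elem (R (Suc (Suc m))) ?L"
    "length ?L = length (R (Suc (Suc m)))"
    using rep by (auto simp: represents_iff R_def length_intervals simp del: right_string.simps)
  have S: "ary_tree (n ` {1..k}) S'" "ary_tree (n ` {1..k}) T'" "w = pl_elem ?S ?T" "length ?S = length ?T"
    using rep' by (auto simp: represents_iff length_intervals)
  have t: "tiles ?L 0 1" "tiles ?S 0 1" "tiles ?T 0 1" and tR: "\<And>m. tiles (R m) 0 1"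
    using subdivision_tiles subdivision_leaf_intervals T(1) S subdivision_R by auto
  have w: "list_all2 (maps_affinely w) (R (Suc (Suc m))) ?L"
    unfolding T(2) by (rule pl_elem_maps_affinely) (use t tR T(3) in auto)
  have w': "list_all2 (maps_affinely w) ?S ?T"
    unfolding S(3) by (rule pl_elem_maps_affinely) (use t S(4) in auto)
  have aff: "affine_on w (fst I) (snd I)" if "list_all2 (maps_affinely w) K K'" "I \<in> set K" for I K K'
    using that maps_affinely_affine_on by (metis in_set_conv_nth list_all2_nthD)
  have p_real: "1 < real p" using p_ge_2 by simp
  obtain A where A: "R m = A @ [(c0, 1)]" using R_last unfolding c0_def by blast
  obtain B where B: "R (Suc m) = B @ [(c, 1)]" using R_last unfolding c_def by blast
  have "pieces p (c0, 1) \<noteq> []"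
    using p_ge_2 by (metis length_pieces list.size(3) not_numeral_le_zero)
  then obtain P J where P: "pieces p (c0, 1) = P @ [J]" by (metis rev_exhaust)
  have "B @ [(c, 1)] = A @ P @ [J]" using R_Suc_append A B P unfolding c0_def by simp
  then have BP: "B = A @ P" by simp
  \<comment> \<open>The leaves of the right string inside \<open>{c0..1}\<close>: those of the last
    caret but one except its final child, then those of the last caret.\<close>
  define M where "M = P @ pieces p (c, 1)"
  have R2: "R (Suc (Suc m)) = A @ M" using R_Suc_append B BP unfolding c_def M_def by simp
  have "tiles A 0 c0" using tR[of m] unfolding A tiles_append by auto
  then have tM: "tiles M c0 1"
    using tR[of "Suc (Suc m)"] tiles_end_unique unfolding R2 tiles_append by blast
  have "M \<noteq> []" using arg_cong[OF M_def, of length] p_ge_2 by auto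
  moreover have "affine_on w (fst I) (snd I)" if "I \<in> set M" for I
    using aff[OF w] that unfolding R2 by simp
  moreover have "\<not> affine_on w c0 1" using not_affine unfolding c0_def .
  \<comment> \<open>Some inner endpoint of \<open>M\<close> is a breakpoint of
    \<open>w\<close>.\<close>
  ultimately obtain I where I: "I \<in> set M" "snd I < 1"
    and no: "\<And>u v. u < snd I \<Longrightarrow> snd I < v \<Longrightarrow> \<not> affine_on w u v"
    using affine_on_tiles[OF tM, of w] by blast
  have x_ge: "c0 \<le> snd I" "0 \<le> c0"
    using tiles_mem[OF tM I(1)] p_real unfolding c0_def by auto
  \<comment> \<open>Endpoints from the upper caret have denominator \<open>p ^ Suc m\<close>, those
    from the lower one \<open>p ^ Suc (Suc m)\<close>.\<close>
  have "\<exists>z :: int. 1 - snd I = z / real p ^ Suc (Suc m)"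
  proof -
    consider "I \<in> set (pieces p (c0, 1))" | "I \<in> set (pieces p (c, 1))" using I(1) P M_def by auto
    then show ?thesis
    proof cases
      case 1
      then obtain i where x: "snd I = c0 + real (Suc i) * ((1 - c0) / real p)"
        by (rule mem_pieces) auto
      then have "1 - snd I = of_int (int p * (int p - int (Suc i))) / real p ^ Suc (Suc m)"
        unfolding x c0_def using p_real by (simp add: field_simps)
      then show ?thesis by blast
    next
      case 2
      then obtain i where x: "snd I = c + real (Suc i) * ((1 - c) / real p)"
        by (rule mem_pieces) auto
      then have "1 - snd I = of_int (int p - int (Suc i)) / real p ^ Suc (Suc m)"
        unfolding x c_def using p_real by (simp add: field_simps)
      then show ?thesis by blast
    qed
  qed
  then obtain z :: int where z: "1 - snd I = z / real p ^ Suc (Suc m)" by blast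
  then have "0 < real_of_int z / real p ^ Suc (Suc m)" using I(2) by linarith
  moreover have "0 < real p ^ Suc (Suc m)" using p_real by simp
  ultimately have "0 < z" by (metis of_int_0_less_iff order.asym zero_less_divide_iff)
  then obtain r :: nat where r: "z = int r" "0 < r" using zero_less_imp_eq_int by blast
  have snd_I: "snd I = 1 - r / real p ^ Suc (Suc m)" using z r by simp
  have "real r / real p ^ Suc (Suc m) \<le> 1 / real p ^ m" using x_ge snd_I unfolding c0_def by simp
  then have "real r \<le> real p * real p" using p_real by (simp add: field_simps)
  then have r_le: "r \<le> p\<^sup>2" by (metis of_nat_le_iff of_nat_mult power2_eq_square)
  have "?S \<noteq> []" using t by auto
  moreover have "snd I \<in> {0..1}" using x_ge I(2) by simp
  ultimately obtain K where K: "K \<in> set ?S" "snd I \<in> {fst K..snd K}" using tiles_cover t(2) by metis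
  have "affine_on w (fst K) (snd K)" using aff[OF w' K(1)] .
  \<comment> \<open>Inside \<open>K\<close> the map is affine, so a breakpoint can only be an end of
    \<open>K\<close>.\<close>
  then have "\<not> (fst K < snd I \<and> snd I < snd K)" using no by blast
  then have "snd I = fst K \<or> snd I = snd K" using K(2) by auto
  then have "snd I * real N ^ leaves S' \<in> \<int>"
    using subdivision_grid[OF subdivision_leaf_intervals[OF S(1)] K(1)] by (auto simp: length_intervals)
  \<comment> \<open>Subtracting from \<open>N ^ leaves S'\<close> leaves
    \<open>r * N ^ leaves S' / p ^ Suc (Suc m)\<close>; its integrality is the divisibility required
    by \<open>exponent_bound\<close>.\<close>
  then have "real N ^ leaves S' - snd I * real N ^ leaves S' \<in> \<int>" by (intro Ints_diff) auto
  moreover have "real N ^ leaves S' - snd I * real N ^ leaves S'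
      = real (r * N ^ leaves S') / real (p ^ Suc (Suc m))"
    unfolding snd_I by (simp add: algebra_simps)
  ultimately have "real (r * N ^ leaves S') / real (p ^ Suc (Suc m)) \<in> \<int>" by simp
  then obtain y :: int where "real (r * N ^ leaves S') / real (p ^ Suc (Suc m)) = of_int y"
    by (elim Ints_cases)
  then have "real (r * N ^ leaves S') = of_int y * real (p ^ Suc (Suc m))"
    using p_real by (simp add: field_simps)
  then have "real_of_int (int (r * N ^ leaves S')) = real_of_int (y * int (p ^ Suc (Suc m)))"
    by simp
  then have "int (r * N ^ leaves S') = y * int (p ^ Suc (Suc m))" by (simp only: of_int_eq_iff)
  then have "int (p ^ Suc (Suc m)) dvd int (r * N ^ leaves S')" by simp
  then have "p ^ Suc (Suc m) dvd r * N ^ leaves S'" by (simp only: int_dvd_int_iff)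
  then have "Suc (Suc m) \<le> r + leaves S' * N" using exponent_bound p_ge_2 r(2) N_pos by blast
  then show ?thesis using r_le by simp
qed

lemma positive_word_bound:
  assumes "w \<in> positive_words k n"
  shows "word_length G X w \<le> enat (3 * ((p\<^sup>2 + N) * p + 1) * min_leaves k n w)"
    and "0 < min_leaves k n w"
proof -
  \<comment> \<open>The least positive diagram: by minimality \<open>positive_diagram_shrink\<close>
    cannot apply to it, so \<open>right_string_depth_le\<close> does.\<close>
  define m where "m = (LEAST m. \<exists>T. represents k n (right_string p m) T w)"
  have "\<exists>m T. represents k n (right_string p m) T w" using assms unfolding positive_words_def by simp
  then have "\<exists>T. represents k n (right_string p m) T w" unfolding m_def by (rule LeastI_ex)
  then obtain T where T: "represents k n (right_string p m) T w" by blast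
  have "\<exists>S T. represents k n S T w \<and> leaves S = min_leaves k n w"
    unfolding min_leaves_def by (rule LeastI) (use T in blast)
  then obtain S' T' where S': "represents k n S' T' w" "leaves S' = min_leaves k n w" by blast
  define l where "l = min_leaves k n w"
  have "0 \<notin> n ` {1..k}" using arity_ge_2 by force
  then have "0 < leaves S'" using S'(1) leaves_pos[of "n ` {1..k}" S'] by (auto simp: represents_iff)
  then show l: "0 < min_leaves k n w" using S' by simp
  have "m \<le> p\<^sup>2 + l * N"
  \<comment> \<open>Both lemmas concern strings with at least two carets.\<close>
  proof (cases "m \<le> 1")
    case True
    have "1 \<le> p\<^sup>2" using p_ge_2 by simp
    then show ?thesis using True by linarith
  next
    case False
    then obtain m' where m': "m = Suc (Suc m')" by (metis One_nat_def not_less_eq_eq old.nat.exhaust zero_le)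
    have "\<not> affine_on w (1 - 1 / real p ^ m') 1"
    proof
      assume "affine_on w (1 - 1 / real p ^ m') 1"
      then have "\<exists>T'. represents k n (right_string p (Suc m')) T' w"
        using positive_diagram_shrink T unfolding m' by blast
      then have "m \<le> Suc m'" unfolding m_def by (rule Least_le)
      then show False using m' by simp
    qed
    then show ?thesis using right_string_depth_le[OF T[unfolded m'] _ S'(1)] S'(2) m' l_def by simp
  qed
  also have "\<dots> \<le> l * (p\<^sup>2 + N)" using l unfolding l_def by (simp add: add_mult_distrib2)
  finally have m: "m \<le> l * (p\<^sup>2 + N)" .
  have rep: "ary_tree (n ` {1..k}) T" "leaves T = m * (p - 1) + 1" "w = pos (leaf_intervals T 0 1)"
    using T pos_eq[of "leaf_intervals T 0 1" m]
    by (auto simp: represents_iff leaves_right_string length_intervals R_def)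
  have "m * (p - 1) + 1 \<le> l * (p\<^sup>2 + N) * p + l"
    using m l unfolding l_def by (intro add_mono mult_le_mono) auto
  also have "\<dots> = ((p\<^sup>2 + N) * p + 1) * l" by (simp add: algebra_simps)
  finally have "3 * leaves T \<le> 3 * (((p\<^sup>2 + N) * p + 1) * l)" using rep(2) by linarith
  then have "3 * leaves T \<le> 3 * ((p\<^sup>2 + N) * p + 1) * l" by (simp only: mult.assoc)
  then show "word_length G X w \<le> enat (3 * ((p\<^sup>2 + N) * p + 1) * min_leaves k n w)"
    using word_length_pos_le[OF rep(1)] unfolding rep(3)[symmetric] l_def
    by (meson enat_ord_simps(1) order_trans)
qed

end

theorem theorem5p4:
  fixes k :: nat and n :: "nat \<Rightarrow> nat"
  assumes "1 \<le> k"
    and "\<And>j. j \<in> {1..k} \<Longrightarrow> 2 \<le> n j"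
    and "\<And>j. j \<in> {1..k} \<Longrightarrow> n 1 - 1 dvd n j - 1"
  shows "\<exists>c :: nat. \<forall>w \<in> positive_words k n.
    word_length (thompson_stein k n) (standard_generators k n) w < enat (c * min_leaves k n w)"
proof -
  interpret thompson_stein_data k n
    using assms by unfold_locales
  let ?c = "3 * ((p\<^sup>2 + N) * p + 1)"
  have "word_length (thompson_stein k n) (standard_generators k n) w < enat (Suc ?c * min_leaves k n w)"
    if "w \<in> positive_words k n" for w
  proof -
    \<comment> \<open>The successor makes the bound strict, because \<open>min_leaves\<close> is
      positive.\<close>
    have "?c * min_leaves k n w < Suc ?c * min_leaves k n w"
      using positive_word_bound(2)[OF that] by simp
    then show ?thesis
      using positive_word_bound(1)[OF that] by (meson enat_ord_simps(2) le_less_trans)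
  qed
  then show ?thesis by blast
qed

end
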